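(* Let $W=W_{D_n}$ and let $M$ be a $K$-module. The action of $y_i$ on the $\ddot{\mathfrak H}^{\mathfrak c}_W$-module $\mathbb C[x_1,\dots,x_n]\otimes M$ is realized as a Dunkl operator as follows. For any polynomial $f\in\mathbb C[x_1,\dots,x_n]$ and $m\in M$, $$\begin{aligned} y_i\circ(f\otimes m)=&-u\sum_{k\ne i}\left(\frac{f-f^{s_{ki}}}{x_i-x_k}+\frac{f-f^{\overline{s}_{ki}}}{x_i+x_k}c_kc_i\right)\otimes s_{ki}m\\ &-u\sum_{k\ne i}\left(\frac{f-f^{\overline{s}_{ki}}}{x_i+x_k}-\frac{f-f^{s_{ki}}}{x_i-x_k}c_kc_i\right)\otimes\overline{s}_{ki}m .\end{aligned}$$
   Context: Ground field $\mathbb C$, $u\in\mathbb C$. $W=W_{D_n}$ ($n\ge4$) is the group of signed permutations of $e_1,\dots,e_n$ with an even number of sign changes. For $i\ne j$: $s_{ij}$ swaps $e_i,e_j$; $\overline{s}_{ij}$ sends $e_i\mapsto-e_j$, $e_j\mapsto-e_i$ (other basis vectors fixed). $\mathcal C_n$ is generated by $c_1,\dots,c_n$ with $c_i^2=1$, $c_ic_j=-c_jc_i$ ($i\ne j$); $W$ acts on the $c_i$ (by algebra automorphisms), on $\mathfrak h^*=\bigoplus\mathbb Cx_i$ and on $\mathfrak h=\bigoplus\mathbb Cy_i$ by the same signed permutations as on the $e_i$. $K=\mathcal C_n\rtimes\mathbb CW$. The rational double affine Hecke-Clifford algebra $\ddot{\mathfrak H}^{\mathfrak c}_W$ of type $D_n$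 is generated by $x_i,y_i,c_i$ ($1\le i\le n$) and $W$, subject to the relations of $K$ and: $x_ix_j=x_jx_i$, $y_iy_j=y_jy_i$, $y_ic_j=c_jy_i$ (all $i,j$); $x_ic_i=-c_ix_i$, $x_ic_j=c_jx_i$ ($i\ne j$); $wxw^{-1}=w(x)$, $wyw^{-1}=w(y)$ ($w\in W$, $x\in\mathfrak h^*$, $y\in\mathfrak h$); $[y_j,x_i]=u\big((1+c_jc_i)s_{ij}-(1-c_jc_i)\overline{s}_{ij}\big)$ ($i\ne j$); $[y_i,x_i]=-u\sum_{k\ne i}\big((1+c_kc_i)s_{ki}+(1-c_kc_i)\overline{s}_{ki}\big)$. It has the triangular decomposition $\mathbb C[x_1,\dots,x_n]\otimes K\otimes\mathbb C[y_1,\dots,y_n]$. Let $\mathfrak H_y$ be the subalgebra generated by $K$ and $y_1,\dots,y_n$. A $K$-module $M$ is extended to an $\mathfrak H_y$-module by letting all $y_i$ act by $0$, and $M_y=\mathrm{Ind}_{\mathfrak H_y}^{\ddot{\mathfrak H}^{\mathfrak c}_W}M$ is identified as a vector space with $\mathbb C[x_1,\dots,x_n]\otimes M$; this is the module structure in question ($\circ$ denotes the action; $x_i$ acts by left multiplication). $f^\sigma$ denotes the action of $\sigma\in W$ on a polynomial $f$. An expression $(p\,a)\otimes m$ with $p\in\mathbb C[x_1,\dots,x_n]$, $a\in\mathcal C_n$ means $p\otimes am$. *)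

theory Defs
  imports "HOL-Algebra.Algebra" "HOL-Library.Cardinality" "HOL-Combinatorics.Transposition"
begin

section \<open>The Weyl group of type D\<close>

text \<open>A pair \<open>(p, \<epsilon>)\<close> stands for the signed permutation sending \<open>e\<^sub>i\<close> to \<open>\<epsilon> i \<cdot> e\<^bsub>p i\<^esub>\<close>.
  The index type has \<open>n\<close> elements. Its linear order is auxiliary: it fixes an ordered monomial
  \<open>x\<^sup>\<alpha>\<close> in the free algebra and gives the polynomial ring its integral domain instance.\<close>

typedef 'n weyl_D =
  "{(p, \<epsilon>). bij p \<and> range \<epsilon> \<subseteq> {1, -1} \<and> even (card {i. \<epsilon> i = -1})}
     :: (('n::finite \<Rightarrow> 'n) \<times> ('n \<Rightarrow> int)) set"
  by (rule exI[of _ "(id, \<lambda>_. 1)"]) auto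

setup_lifting type_definition_weyl_D

lift_definition wperm :: "'n::finite weyl_D \<Rightarrow> 'n \<Rightarrow> 'n" is fst .
lift_definition wsign :: "'n::finite weyl_D \<Rightarrow> 'n \<Rightarrow> int" is snd .

lemma prod_sign_iff:
  fixes \<epsilon> :: "'n::finite \<Rightarrow> int"
  assumes "range \<epsilon> \<subseteq> {1, -1}"
  shows "even (card {i. \<epsilon> i = -1}) \<longleftrightarrow> (\<Prod>i\<in>UNIV. \<epsilon> i) = 1"
proof -
  have "(\<Prod>i\<in>UNIV. \<epsilon> i) = (\<Prod>i\<in>UNIV. if \<epsilon> i = -1 then -1 else 1)"
    using assms by (intro prod.cong) auto
  also have "\<dots> = (-1) ^ card {i. \<epsilon> i = -1}"
    by (simp add: prod.If_cases)
  finally show ?thesis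
    by (simp add: minus_one_power_iff)
qed

instantiation weyl_D :: (finite) monoid_mult
begin

lift_definition one_weyl_D :: "'a weyl_D" is "(id, \<lambda>_. 1)"
  by auto

lift_definition times_weyl_D :: "'a weyl_D \<Rightarrow> 'a weyl_D \<Rightarrow> 'a weyl_D"
  is "\<lambda>(p, \<epsilon>) (q, \<delta>). (p \<circ> q, \<lambda>i. \<delta> i * \<epsilon> (q i))"
proof (clarify, intro conjI)
  fix p q :: "'a \<Rightarrow> 'a" and \<epsilon> \<delta> :: "'a \<Rightarrow> int"
  assume p: "bij p" and q: "bij q"
    and e: "range \<epsilon> \<subseteq> {1, -1}" "even (card {i. \<epsilon> i = -1})"
    and d: "range \<delta> \<subseteq> {1, -1}" "even (card {i. \<delta> i = -1})"
  show "bij (p \<circ> q)" using q p by (rule bij_comp)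
  have "\<delta> i * \<epsilon> (q i) \<in> {1, -1}" for i
  proof -
    have "\<delta> i \<in> {1, -1}" "\<epsilon> (q i) \<in> {1, -1}" using e(1) d(1) by blast+
    then show ?thesis by auto
  qed
  then show r: "range (\<lambda>i. \<delta> i * \<epsilon> (q i)) \<subseteq> {1, -1}" by blast
  have "(\<Prod>i\<in>UNIV. \<epsilon> (q i)) = (\<Prod>i\<in>UNIV. \<epsilon> i)"
    using q by (rule prod.reindex_bij_betw)
  then have "(\<Prod>i\<in>UNIV. \<delta> i * \<epsilon> (q i)) = 1"
    using e d by (simp add: prod_sign_iff prod.distrib)
  then show "even (card {i. \<delta> i * \<epsilon> (q i) = -1})"
    using r by (simp add: prod_sign_iff)
qed

instance
  by standard (transfer; auto simp: fun_eq_iff)+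

end

lift_definition s_refl :: "'n::finite \<Rightarrow> 'n \<Rightarrow> 'n weyl_D"
  is "\<lambda>i j. (transpose i j, \<lambda>_. 1)"
  by auto

text \<open>Only meaningful for \<open>i \<noteq> j\<close>; the condition keeps the function total.\<close>

lift_definition sbar_refl :: "'n::finite \<Rightarrow> 'n \<Rightarrow> 'n weyl_D"
  is "\<lambda>i j. (transpose i j, \<lambda>k. if i \<noteq> j \<and> k \<in> {i, j} then -1 else 1)"
proof (clarify, intro conjI)
  fix i j :: 'n
  show "bij (transpose i j)" by simp
  show "range (\<lambda>k. if i \<noteq> j \<and> k \<in> {i, j} then - 1 else 1) \<subseteq> {1, - 1 :: int}" by auto
  have "{k. (if i \<noteq> j \<and> k \<in> {i, j} then - 1 else 1) = (-1 :: int)} = (if i \<noteq> j then {i, j} else {})"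
    by auto
  then show "even (card {k. (if i \<noteq> j \<and> k \<in> {i, j} then - 1 else 1) = (-1 :: int)})"
    by simp
qed


section \<open>Algebras presented by generators and relations\<close>

datatype 'g word = Word "'g list"

instantiation word :: (type) monoid_add
begin

definition zero_word :: "'a word" where "zero_word = Word []"

fun plus_word :: "'a word \<Rightarrow> 'a word \<Rightarrow> 'a word" where
  "plus_word (Word v) (Word w) = Word (v @ w)"

instance
proof
  fix a b c :: "'a word"
  show "a + b + c = a + (b + c)" by (cases a; cases b; cases c) simp
  show "0 + a = a" by (cases a) (simp add: zero_word_def)
  show "a + 0 = a" by (cases a) (simp add: zero_word_def)
qed

end

text \<open>The monoid algebra of the free monoid, i.e. the free unital associative algebra.\<close>

type_synonym 'g free_alg = "'g word \<Rightarrow>\<^sub>0 complex"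

definition const :: "complex \<Rightarrow> ('a::monoid_add \<Rightarrow>\<^sub>0 complex)" where
  "const a = Poly_Mapping.single 0 a"

definition gen :: "'g \<Rightarrow> 'g free_alg" where
  "gen g = Poly_Mapping.single (Word [g]) 1"

definition free_alg_ring :: "'g free_alg ring" where
  "free_alg_ring = \<lparr>carrier = UNIV, monoid.mult = (*), one = 1, ring.zero = 0, add = (+)\<rparr>"

definition rel_ideal :: "'g free_alg set \<Rightarrow> 'g free_alg set" where
  "rel_ideal R = Idl\<^bsub>free_alg_ring\<^esub> R"

definition presented :: "'g free_alg set \<Rightarrow> 'g free_alg set ring" where
  "presented R = free_alg_ring Quot rel_ideal R"

definition cls :: "'g free_alg set \<Rightarrow> 'g free_alg \<Rightarrow> 'g free_alg set" where
  "cls R a = rel_ideal R +>\<^bsub>free_alg_ring\<^esub> a"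

definition left_module :: "('r, 'x) ring_scheme \<Rightarrow> ('r \<Rightarrow> 'm::ab_group_add \<Rightarrow> 'm) \<Rightarrow> bool" where
  "left_module R act \<longleftrightarrow> ring R \<and>
     (\<forall>a\<in>carrier R. \<forall>m m'. act a (m + m') = act a m + act a m') \<and>
     (\<forall>a\<in>carrier R. \<forall>b\<in>carrier R. \<forall>m. act (a \<oplus>\<^bsub>R\<^esub> b) m = act a m + act b m) \<and>
     (\<forall>a\<in>carrier R. \<forall>b\<in>carrier R. \<forall>m. act (a \<otimes>\<^bsub>R\<^esub> b) m = act a (act b m)) \<and>
     (\<forall>m. act \<one>\<^bsub>R\<^esub> m = m)"


section \<open>Induced modules\<close>

text \<open>For a subring \<open>S\<close> of \<open>R\<close> and a left \<open>S\<close>-module \<open>M\<close>, the tensor product of \<open>R\<close> and \<open>M\<close>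
  over \<open>S\<close> is the free abelian group on \<open>R \<times> M\<close> modulo the biadditivity and balancing relations.\<close>

definition tensor_relations ::
  "('r, 'x) ring_scheme \<Rightarrow> 'r set \<Rightarrow> ('r \<Rightarrow> 'm::ab_group_add \<Rightarrow> 'm) \<Rightarrow> ('r \<times> 'm \<Rightarrow>\<^sub>0 int) set" where
  "tensor_relations R S act =
     {frag_of (a \<oplus>\<^bsub>R\<^esub> b, m) - frag_of (a, m) - frag_of (b, m) | a b m. a \<in> carrier R \<and> b \<in> carrier R} \<union>
     {frag_of (a, m + m') - frag_of (a, m) - frag_of (a, m') | a m m'. a \<in> carrier R} \<union>
     {frag_of (a \<otimes>\<^bsub>R\<^esub> s, m) - frag_of (a, act s m) | a s m. a \<in> carrier R \<and> s \<in> S}"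

definition tensor_coset ::
  "('r, 'x) ring_scheme \<Rightarrow> 'r set \<Rightarrow> ('r \<Rightarrow> 'm::ab_group_add \<Rightarrow> 'm) \<Rightarrow>
   ('r \<times> 'm \<Rightarrow>\<^sub>0 int) \<Rightarrow> ('r \<times> 'm \<Rightarrow>\<^sub>0 int) set" where
  "tensor_coset R S act z =
     (let F = free_Abelian_group (carrier R \<times> (UNIV :: 'm set))
      in generate F (tensor_relations R S act) #>\<^bsub>F\<^esub> z)"

text \<open>The elements of the induced module are the cosets \<open>tensor_coset R S act z\<close> with
  \<open>z \<in> carrier (free_Abelian_group (carrier R \<times> UNIV))\<close>; the ring acts by
  \<open>a \<cdot> (b \<otimes> m) = (a b) \<otimes> m\<close>.\<close>

definition induced_act ::
  "('r, 'x) ring_scheme \<Rightarrow> 'r set \<Rightarrow> ('r \<Rightarrow> 'm::ab_group_add \<Rightarrow> 'm) \<Rightarrow>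
   'r \<Rightarrow> ('r \<times> 'm \<Rightarrow>\<^sub>0 int) set \<Rightarrow> ('r \<times> 'm \<Rightarrow>\<^sub>0 int) set" where
  "induced_act R S act a T =
     (\<Union>z\<in>T. tensor_coset R S act (frag_extend (\<lambda>(b, m). frag_of (a \<otimes>\<^bsub>R\<^esub> b, m)) z))"


section \<open>The algebras\<close>

text \<open>Here \<open>c\<close> and \<open>g\<close> are the images of the Clifford generators and of the Weyl group in the
  algebra under consideration, so that the same relations serve for both algebras below.\<close>

definition K_relations :: "('n::finite \<Rightarrow> 'a::ring_1) \<Rightarrow> ('n weyl_D \<Rightarrow> 'a) \<Rightarrow> 'a set" where
  "K_relations c g =
     {c i * c i - 1 | i. True} \<union>
     {c i * c j + c j * c i | i j. i \<noteq> j} \<union>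
     {g 1 - 1} \<union>
     {g w * g v - g (w * v) | w v. True} \<union>
     {g w * c i * g v - of_int (wsign w i) * c (wperm w i) | w v i. w * v = 1}"

datatype 'n K_gen = KC 'n | KW "'n weyl_D"

definition K_rels :: "'n::finite K_gen free_alg set" where
  "K_rels = K_relations (\<lambda>i. gen (KC i)) (\<lambda>w. gen (KW w))"

definition K_alg :: "'n::finite K_gen free_alg set ring" where
  "K_alg = presented K_rels"

datatype 'n H_gen = HX 'n | HY 'n | HC 'n | HW "'n weyl_D"

definition H_rels :: "complex \<Rightarrow> 'n::finite H_gen free_alg set" where
  "H_rels u =
    (let x = (\<lambda>i. gen (HX i)); y = (\<lambda>i. gen (HY i)); c = (\<lambda>i. gen (HC i)); g = (\<lambda>w. gen (HW w))
     in K_relations c g \<union>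
        {x i * x j - x j * x i | i j. True} \<union>
        {y i * y j - y j * y i | i j. True} \<union>
        {y i * c j - c j * y i | i j. True} \<union>
        {x i * c i + c i * x i | i. True} \<union>
        {x i * c j - c j * x i | i j. i \<noteq> j} \<union>
        {g w * x i * g v - of_int (wsign w i) * x (wperm w i) | w v i. w * v = 1} \<union>
        {g w * y i * g v - of_int (wsign w i) * y (wperm w i) | w v i. w * v = 1} \<union>
        {y j * x i - x i * y j
           - const u * ((1 + c j * c i) * g (s_refl i j) - (1 - c j * c i) * g (sbar_refl i j))
           | i j. i \<noteq> j} \<union>
        {y i * x i - x i * y i
           + const u * (\<Sum>k\<in>UNIV - {i}. (1 + c k * c i) * g (s_refl k i)
                                        + (1 - c k * c i) * g (sbar_refl k i))
           | i. True})"

definition H_alg :: "complex \<Rightarrow> 'n::finite H_gen free_alg set ring" where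
  "H_alg u = presented (H_rels u)"

definition Hy_alg :: "complex \<Rightarrow> 'n::finite H_gen free_alg set ring" where
  "Hy_alg u = (H_alg u)\<lparr>carrier := generate_ring (H_alg u)
     (cls (H_rels u) ` (range const \<union> range (\<lambda>i. gen (HC i)) \<union> range (\<lambda>w. gen (HW w))
        \<union> range (\<lambda>i. gen (HY i))))\<rparr>"


section \<open>The induced module of a K-module\<close>

text \<open>The \<open>\<H>\<^sub>y\<close>-module structure on \<open>M\<close> extending the \<open>K\<close>-module structure \<open>act\<close> with
  all \<open>y\<^sub>i\<close> acting by 0. Agreement over \<open>K\<close> is expressed on the scalars and generators.
  The conditions determine the action on all of \<open>\<H>\<^sub>y\<close>, so the choice is
  immaterial; existence comes from the triangular decomposition.\<close>

definition is_zero_extension ::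
  "complex \<Rightarrow> ('n::finite K_gen free_alg set \<Rightarrow> 'm::ab_group_add \<Rightarrow> 'm) \<Rightarrow>
   ('n H_gen free_alg set \<Rightarrow> 'm \<Rightarrow> 'm) \<Rightarrow> bool" where
  "is_zero_extension u act \<rho> \<longleftrightarrow> left_module (Hy_alg u) \<rho> \<and>
     (\<forall>a m. \<rho> (cls (H_rels u) (const a)) m = act (cls K_rels (const a)) m) \<and>
     (\<forall>i m. \<rho> (cls (H_rels u) (gen (HC i))) m = act (cls K_rels (gen (KC i))) m) \<and>
     (\<forall>w m. \<rho> (cls (H_rels u) (gen (HW w))) m = act (cls K_rels (gen (KW w))) m) \<and>
     (\<forall>i m. \<rho> (cls (H_rels u) (gen (HY i))) m = 0)"

definition zero_extension ::
  "complex \<Rightarrow> ('n::finite K_gen free_alg set \<Rightarrow> 'm::ab_group_add \<Rightarrow> 'm) \<Rightarrow>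
   ('n H_gen free_alg set \<Rightarrow> 'm \<Rightarrow> 'm)" where
  "zero_extension u act = (SOME \<rho>. is_zero_extension u act \<rho>)"

type_synonym 'n poly_ring = "('n \<Rightarrow>\<^sub>0 nat) \<Rightarrow>\<^sub>0 complex"

text \<open>The tensor product of the polynomial ring with \<open>M\<close> over the complex numbers, as the space of
  polynomials with coefficients in \<open>M\<close>.\<close>

type_synonym ('n, 'm) poly_tensor = "('n \<Rightarrow>\<^sub>0 nat) \<Rightarrow>\<^sub>0 'm"

definition pure_tensor ::
  "('n::finite K_gen free_alg set \<Rightarrow> 'm::ab_group_add \<Rightarrow> 'm) \<Rightarrow> 'n poly_ring \<Rightarrow> 'm \<Rightarrow>
   ('n, 'm) poly_tensor" where
  "pure_tensor act f m =
     (\<Sum>\<alpha>\<in>Poly_Mapping.keys f. Poly_Mapping.single \<alpha> (act (cls K_rels (const (Poly_Mapping.lookup f \<alpha>))) m))"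

definition tensor_scale ::
  "('n::finite K_gen free_alg set \<Rightarrow> 'm::ab_group_add \<Rightarrow> 'm) \<Rightarrow> complex \<Rightarrow>
   ('n, 'm) poly_tensor \<Rightarrow> ('n, 'm) poly_tensor" where
  "tensor_scale act a t = Poly_Mapping.map (act (cls K_rels (const a))) t"

definition x_monomial :: "('n::{finite,linorder} \<Rightarrow>\<^sub>0 nat) \<Rightarrow> 'n H_gen free_alg" where
  "x_monomial \<alpha> =
     prod_list (map (\<lambda>i. gen (HX i) ^ Poly_Mapping.lookup \<alpha> i) (sorted_list_of_set UNIV))"

text \<open>The identification of \<open>\<complex>[x] \<otimes> M\<close> with the induced module, \<open>x\<^sup>\<alpha> \<otimes> m \<mapsto> x\<^sup>\<alpha> \<otimes> m\<close>;
  it is bijective by the triangular decomposition.\<close>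

definition identification ::
  "complex \<Rightarrow> ('n::{finite,linorder} K_gen free_alg set \<Rightarrow> 'm::ab_group_add \<Rightarrow> 'm) \<Rightarrow>
   ('n, 'm) poly_tensor \<Rightarrow> ('n H_gen free_alg set \<times> 'm \<Rightarrow>\<^sub>0 int) set" where
  "identification u act t =
     tensor_coset (H_alg u) (carrier (Hy_alg u)) (zero_extension u act)
       (\<Sum>\<alpha>\<in>Poly_Mapping.keys t. frag_of (cls (H_rels u) (x_monomial \<alpha>), Poly_Mapping.lookup t \<alpha>))"

definition module_act ::
  "complex \<Rightarrow> ('n::{finite,linorder} K_gen free_alg set \<Rightarrow> 'm::ab_group_add \<Rightarrow> 'm) \<Rightarrow>
   'n H_gen free_alg set \<Rightarrow> ('n, 'm) poly_tensor \<Rightarrow> ('n, 'm) poly_tensor" where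
  "module_act u act h t =
     inv_into UNIV (identification u act)
       (induced_act (H_alg u) (carrier (Hy_alg u)) (zero_extension u act) h (identification u act t))"


section \<open>Divided differences\<close>

definition px :: "'n \<Rightarrow> 'n poly_ring" where
  "px i = Poly_Mapping.single (Poly_Mapping.single i 1) 1"

text \<open>The algebra automorphism with \<open>x\<^sub>i \<mapsto> w(x\<^sub>i)\<close>.\<close>

definition poly_act :: "'n::finite weyl_D \<Rightarrow> 'n poly_ring \<Rightarrow> 'n poly_ring" where
  "poly_act w f = (\<Sum>\<alpha>\<in>Poly_Mapping.keys f. const (Poly_Mapping.lookup f \<alpha>) *
     (\<Prod>i\<in>UNIV. (of_int (wsign w i) * px (wperm w i)) ^ Poly_Mapping.lookup \<alpha> i))"

definition poly_quot :: "'n::{finite,linorder} poly_ring \<Rightarrow> 'n poly_ring \<Rightarrow> 'n poly_ring" where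
  "poly_quot f d = (THE q. q * d = f)"

definition ddiff :: "'n::{finite,linorder} \<Rightarrow> 'n \<Rightarrow> 'n poly_ring \<Rightarrow> 'n poly_ring" where
  "ddiff i k f = poly_quot (f - poly_act (s_refl k i) f) (px i - px k)"

definition ddiff_bar :: "'n::{finite,linorder} \<Rightarrow> 'n \<Rightarrow> 'n poly_ring \<Rightarrow> 'n poly_ring" where
  "ddiff_bar i k f = poly_quot (f - poly_act (sbar_refl k i) f) (px i + px k)"

end

(* The Dunkl formula defines operators on polynomials with coefficients in M. The Leibniz rule for
   divided differences gives the prescribed commutators [y_i, x_j], and y_i kills the constants;
   since the constants generate under the x_i, all other defining relations, including
   y_i y_j = y_j y_i, follow by induction on the degree. So the polynomials form a module over the
   algebra. This module shows that the zero extension exists and, by the universal property of the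
   tensor product, that the identification with the induced module is injective. Conversely, pushing
   y_i past the x_j in the induced module, where it ends up killing 1 (x) M, reproduces the same
   recursion, so the identification intertwines the two actions. *)
theory Submission
  imports Defs
begin

text \<open>The shape of the formula comes from the Clifford factor: conjugation by c_k c_i changes
  the signs of x_k and x_i, so moving c_k c_i past f^s turns f^s into f^sbar. This is why s_ki
  occurs with both divided differences.

  Commutativity of the y_i reduces to the Jacobi identity for y_i, y_j, x_k. Its only nontrivial
  cases are k = i and k = j, where the off-diagonal commutator cancels against the one part of the
  diagonal sum that moves the other y.

  The action on the induced module is defined through two choices. The zero extension is an
  arbitrary one, so besides existence its agreement with the polynomial module on constants has to
  be shown, by induction over the generated subring. The identification is inverted by
  \<open>inv_into\<close>, so the action of y_i is determined by injectivity together with an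
  explicit preimage of the result, the Dunkl operator applied to t. The left inverse that gives
  injectivity lets a act on the constant m, and that agreement makes it balanced.\<close>

lemma poly_mapping_single_add_induct [case_names single add]:
  fixes f :: "'k \<Rightarrow>\<^sub>0 'a::comm_monoid_add"
  assumes single: "\<And>k a. P (Poly_Mapping.single k a)"
    and add: "\<And>f g. P f \<Longrightarrow> P g \<Longrightarrow> P (f + g)"
  shows "P f"
proof (induction f rule: Poly_Mapping.update_induct)
  case const
  show ?case using single[of _ 0] by simp
next
  case (update f k a)
  have "Poly_Mapping.update k a f = Poly_Mapping.single k a + f"
    using update(1)
    by (intro poly_mapping_eqI)
      (auto simp: lookup_update lookup_add lookup_single when_def in_keys_iff)
  then show ?case using add[OF single update(3)] by simp
qed

text \<open>Additive extension of a map given on single terms. Most operators below are of this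
  form, so their additivity has one common proof.\<close>

definition pm_extend ::
  "('k \<Rightarrow> 'a::zero \<Rightarrow> 'b::comm_monoid_add) \<Rightarrow> ('k \<Rightarrow>\<^sub>0 'a) \<Rightarrow> 'b" where
  "pm_extend h f = (\<Sum>k\<in>Poly_Mapping.keys f. h k (Poly_Mapping.lookup f k))"

lemma pm_extend_single: "h k 0 = 0 \<Longrightarrow> pm_extend h (Poly_Mapping.single k a) = h k a"
  by (simp add: pm_extend_def)

lemma additive_pm_extend:
  assumes "\<And>k. additive (h k)"
  shows "additive (pm_extend h)"
  unfolding additive_def pm_extend_def
  by (intro allI setsum_keys_plus_distrib)
    (simp_all add: assms additive.zero additive.add lookup_add)

lemma additive_single: "additive (Poly_Mapping.single k)"
  by (simp add: additive_def single_add)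


section \<open>Presented algebras\<close>

primrec letters :: "'g word \<Rightarrow> 'g list" where
  "letters (Word l) = l"

lemma letters_plus [simp]: "letters (v + w) = letters v @ letters w"
  by (cases v; cases w) simp

lemma letters_zero [simp]: "letters 0 = []"
  by (simp add: zero_word_def)

text \<open>Scalars are central in the free algebra, hence \<open>E_S\<close>: coefficients must
  slide past the operators of the letters for evaluation to respect products.\<close>

locale free_alg_rep =
  fixes S :: "complex \<Rightarrow> 'p::ab_group_add \<Rightarrow> 'p" and E :: "'g \<Rightarrow> 'p \<Rightarrow> 'p"
  assumes S_additive: "additive (S a)"
    and S_add_left: "S (a + b) t = S a t + S b t"
    and S_mult: "S (a * b) t = S a (S b t)"
    and S_one [simp]: "S 1 t = t"
    and E_additive: "additive (E g)"
    and E_S: "E g (S a t) = S a (E g t)"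
begin

definition ev :: "'g free_alg \<Rightarrow> 'p \<Rightarrow> 'p" where
  "ev a t = pm_extend (\<lambda>w z. S z (foldr E (letters w) t)) a"

lemma S_additive_left: "additive (\<lambda>a. S a t)"
  by (simp add: additive_def S_add_left)

lemma S_0 [simp]: "S 0 t = 0"
  using additive.zero[OF S_additive_left] .

lemma foldr_additive: "additive (foldr E l)"
  by (induction l) (simp_all add: additive_def additive.add[OF E_additive])

lemma foldr_S: "foldr E l (S a t) = S a (foldr E l t)"
  by (induction l) (simp_all add: E_S)

lemma ev_additive_left: "additive (\<lambda>a. ev a t)"
  unfolding ev_def by (intro additive_pm_extend S_additive_left)

lemmas ev_add = additive.add[OF ev_additive_left]
  and ev_diff = additive.diff[OF ev_additive_left]
  and ev_minus = additive.minus[OF ev_additive_left]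
  and ev_0 = additive.zero[OF ev_additive_left]
  and ev_sum = additive.sum[OF ev_additive_left]

lemma ev_single: "ev (Poly_Mapping.single w a) t = S a (foldr E (letters w) t)"
  unfolding ev_def by (rule pm_extend_single) simp

lemma ev_const: "ev (const a) t = S a t"
  by (simp add: const_def ev_single)

lemma ev_gen: "ev (gen g) t = E g t"
  by (simp add: gen_def ev_single)

lemma ev_one: "ev 1 t = t"
  by (simp flip: single_one add: ev_single)

lemma ev_additive: "additive (ev a)"
  unfolding additive_def
proof (intro allI)
  show "ev a (s + t) = ev a s + ev a t" for s t
    by (induction a rule: poly_mapping_single_add_induct)
      (simp_all add: ev_single ev_add additive.add[OF S_additive] additive.add[OF foldr_additive])
qed

lemma ev_mult: "ev (a * b) t = ev a (ev b t)"
proof (induction a rule: poly_mapping_single_add_induct)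
  case (single v x)
  show ?case
  proof (induction b rule: poly_mapping_single_add_induct)
    case (single w y)
    show ?case by (simp add: mult_single ev_single S_mult foldr_S)
  qed (simp add: distrib_left ev_add additive.add[OF ev_additive])
qed (simp add: distrib_right ev_add)

end

section \<open>The quotient ring and its modules\<close>

lemma ring_free_alg_ring: "ring (free_alg_ring :: 'g free_alg ring)"
proof (rule ringI)
  show "abelian_group (free_alg_ring :: 'g free_alg ring)"
    by (rule abelian_groupI)
      (auto simp: free_alg_ring_def algebra_simps intro: exI[of _ "- x" for x])
  show "Group.monoid (free_alg_ring :: 'g free_alg ring)"
    by unfold_locales (auto simp: free_alg_ring_def mult.assoc)
qed (auto simp: free_alg_ring_def algebra_simps)

interpretation free_alg: ring "free_alg_ring :: 'g free_alg ring"
  by (rule ring_free_alg_ring)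

lemma free_alg_ring_simps [simp]:
  "carrier free_alg_ring = UNIV" "a \<otimes>\<^bsub>free_alg_ring\<^esub> b = a * b" "a \<oplus>\<^bsub>free_alg_ring\<^esub> b = a + b"
  "\<one>\<^bsub>free_alg_ring\<^esub> = 1" "\<zero>\<^bsub>free_alg_ring\<^esub> = 0"
  by (simp_all add: free_alg_ring_def)

lemma free_alg_ring_a_inv [simp]: "\<ominus>\<^bsub>free_alg_ring\<^esub> a = - (a :: 'g free_alg)"
  by (rule free_alg.minus_equality) simp_all

lemma free_alg_ring_a_minus [simp]: "a \<ominus>\<^bsub>free_alg_ring\<^esub> b = a - (b :: 'g free_alg)"
  by (simp add: a_minus_def)

lemma ideal_rel_ideal: "ideal (rel_ideal R) free_alg_ring"
  unfolding rel_ideal_def by (rule free_alg.genideal_ideal) simp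

lemma ring_presented: "ring (presented R)"
  unfolding presented_def by (rule ideal.quotient_is_ring[OF ideal_rel_ideal])

lemma carrier_presented: "carrier (presented R) = range (cls R)"
  unfolding presented_def FactRing_def cls_def by (auto simp: A_RCOSETS_def')

lemma cls_in_carrier [simp]: "cls R a \<in> carrier (presented R)"
  by (simp add: carrier_presented)

lemma cls_hom: "cls R \<in> ring_hom free_alg_ring (presented R)"
  using ideal.rcos_ring_hom[OF ideal_rel_ideal]
  by (simp add: presented_def cls_def [abs_def])

lemma cls_add: "cls R (a + b) = cls R a \<oplus>\<^bsub>presented R\<^esub> cls R b"
  using ring_hom_add[OF cls_hom, of a b] by simp

lemma cls_mult: "cls R (a * b) = cls R a \<otimes>\<^bsub>presented R\<^esub> cls R b"
  using ring_hom_mult[OF cls_hom, of a b] by simp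

lemma cls_one: "cls R 1 = \<one>\<^bsub>presented R\<^esub>"
  using ring_hom_one[OF cls_hom] by simp

lemma cls_eq_iff: "cls R a = cls R b \<longleftrightarrow> a - b \<in> rel_ideal R"
  using free_alg.quotient_eq_iff_same_a_r_cos[OF ideal_rel_ideal, of a b]
  by (simp add: cls_def)

lemma cls_0: "cls R 0 = \<zero>\<^bsub>presented R\<^esub>"
proof -
  interpret ring "presented R" by (rule ring_presented)
  show ?thesis using cls_add[of R 0 0] by (simp add: add.r_cancel_one')
qed

lemma cls_minus: "cls R (- a) = \<ominus>\<^bsub>presented R\<^esub> cls R a"
proof -
  interpret ring "presented R" by (rule ring_presented)
  show ?thesis using cls_add[of R "- a" a] by (simp add: cls_0 minus_equality)
qed

lemma rel_in_rel_ideal: "r \<in> R \<Longrightarrow> r \<in> rel_ideal R"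
  unfolding rel_ideal_def using free_alg.genideal_self[of R] by auto

lemma cls_eq_rel: "a - b \<in> R \<Longrightarrow> cls R a = cls R b"
  by (simp add: cls_eq_iff rel_in_rel_ideal)

text \<open>The elements that annihilate the whole module form a two-sided ideal, so only the
  relations have to be checked. They must vanish at every t, since a right factor changes the
  argument.\<close>

lemma (in free_alg_rep) ev_rel_ideal:
  assumes R: "\<And>r t. r \<in> R \<Longrightarrow> ev r t = 0" and "a \<in> rel_ideal R"
  shows "ev a t = 0"
proof -
  let ?I = "{a. \<forall>t. ev a t = 0}"
  have "ideal ?I free_alg_ring"
  proof (rule idealI[OF ring_free_alg_ring])
    show "subgroup ?I (add_monoid free_alg_ring)"
      by (rule free_alg.add.subgroupI)
        (auto simp: ev_0 ev_add ev_minus simp flip: a_inv_def intro: exI[of _ 0])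
  qed (auto simp: ev_mult additive.zero[OF ev_additive])
  then have "rel_ideal R \<subseteq> ?I"
    unfolding rel_ideal_def by (rule free_alg.genideal_minimal) (use R in auto)
  with assms(2) show ?thesis by auto
qed

lemma (in free_alg_rep) ev_cong:
  assumes "\<And>r t. r \<in> R \<Longrightarrow> ev r t = 0" and "cls R a = cls R b"
  shows "ev a t = ev b t"
  using ev_rel_ideal[OF assms(1), of R "a - b"] assms(2) by (simp add: cls_eq_iff ev_diff)

context
  fixes R :: "'g free_alg set" and act :: "'g free_alg set \<Rightarrow> 'm::ab_group_add \<Rightarrow> 'm"
  assumes mod: "left_module (presented R) act"
begin

lemma act_cls_add_left: "act (cls R (a + b)) m = act (cls R a) m + act (cls R b) m"
  using mod unfolding left_module_def by (simp add: cls_add)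

lemma act_cls_additive_left: "additive (\<lambda>a. act (cls R a) m)"
  by (simp add: additive_def act_cls_add_left)

lemma act_cls_mult: "act (cls R (a * b)) m = act (cls R a) (act (cls R b) m)"
  using mod unfolding left_module_def by (simp add: cls_mult)

lemma act_cls_one: "act (cls R 1) m = m"
  using mod unfolding left_module_def by (simp add: cls_one)

lemma act_cls_additive: "additive (act (cls R a))"
  using mod unfolding left_module_def additive_def by simp

lemma act_cls_eq_rel: "a - b \<in> R \<Longrightarrow> act (cls R a) m = act (cls R b) m"
  by (simp add: cls_eq_rel)

end

section \<open>Weyl group action and divided differences on polynomials\<close>

lemma wperm_s_refl [simp]: "wperm (s_refl i j) = transpose i j"
  by (simp add: wperm.rep_eq s_refl.rep_eq)

lemma wsign_s_refl [simp]: "wsign (s_refl i j) k = 1"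
  by (simp add: wsign.rep_eq s_refl.rep_eq)

lemma wperm_sbar_refl [simp]: "wperm (sbar_refl i j) = transpose i j"
  by (simp add: wperm.rep_eq sbar_refl.rep_eq)

lemma wsign_sbar_refl [simp]: "wsign (sbar_refl i j) k = (if i \<noteq> j \<and> k \<in> {i, j} then -1 else 1)"
  by (simp add: wsign.rep_eq sbar_refl.rep_eq)

lemma wperm_one [simp]: "wperm 1 i = i" and wsign_one [simp]: "wsign 1 i = 1"
  by (transfer; simp)+

lemma wperm_mult [simp]: "wperm (w * v) i = wperm w (wperm v i)"
  by transfer auto

lemma wsign_mult [simp]: "wsign (w * v) i = wsign v i * wsign w (wperm v i)"
  by transfer auto

lemma weyl_D_eqI:
  "(\<And>i. wperm w i = wperm v i) \<Longrightarrow> (\<And>i. wsign w i = wsign v i) \<Longrightarrow> w = v"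
  by transfer (auto simp: fun_eq_iff)

lemma bij_wperm: "bij (wperm w)"
  by transfer auto

lemma wperm_inj [simp]: "wperm w i = wperm w j \<longleftrightarrow> i = j"
  using bij_wperm[of w] by (auto dest: bij_is_inj injD)

lemma wsign_cases: "wsign w i = 1 \<or> wsign w i = -1"
  by transfer (auto simp: image_subset_iff)

lemma s_refl_commute: "s_refl i j = s_refl j i"
  by (rule weyl_D_eqI) (auto simp: transpose_commute)

lemma sbar_refl_commute: "sbar_refl i j = sbar_refl j i"
  by (rule weyl_D_eqI) (auto simp: transpose_commute)

lemma transpose_wperm:
  "transpose (wperm w i) (wperm w j) (wperm w k) = wperm w (transpose i j k)"
  by (simp add: transpose_def)

text \<open>Up to sign, w sends the root e_i - e_j to the difference or the sum of the image basis
  vectors, depending on whether w has equal signs on i and j. The form \<open>w * s = s' * w\<close>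
  of this conjugation avoids inverses.\<close>

lemma weyl_D_mult_s_refl:
  assumes "i \<noteq> j"
  shows "w * s_refl i j = (if wsign w i = wsign w j then s_refl (wperm w i) (wperm w j)
      else sbar_refl (wperm w i) (wperm w j)) * w" (is "_ = ?v * w")
proof (intro weyl_D_eqI)
  fix k
  show "wperm (w * s_refl i j) k = wperm (?v * w) k"
    by (simp add: transpose_wperm)
  show "wsign (w * s_refl i j) k = wsign (?v * w) k"
    using assms wsign_cases[of w i] wsign_cases[of w j]
    by (cases "k = i"; cases "k = j") (auto simp: transpose_apply_other)
qed

lemma weyl_D_mult_sbar_refl:
  assumes "i \<noteq> j"
  shows "w * sbar_refl i j = (if wsign w i = wsign w j then sbar_refl (wperm w i) (wperm w j)
      else s_refl (wperm w i) (wperm w j)) * w" (is "_ = ?v * w")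
proof (intro weyl_D_eqI)
  fix k
  show "wperm (w * sbar_refl i j) k = wperm (?v * w) k"
    by (simp add: transpose_wperm)
  show "wsign (w * sbar_refl i j) k = wsign (?v * w) k"
    using assms wsign_cases[of w i] wsign_cases[of w j]
    by (cases "k = i"; cases "k = j") (auto simp: transpose_apply_other)
qed

section \<open>Polynomials and the action of W on them\<close>

lemma monomial_induct [case_names zero step]:
  fixes \<alpha> :: "'n \<Rightarrow>\<^sub>0 nat"
  assumes zero: "P 0" and step: "\<And>i \<alpha>. P \<alpha> \<Longrightarrow> P (Poly_Mapping.single i 1 + \<alpha>)"
  shows "P \<alpha>"
proof -
  \<comment> \<open>A starting monomial \<beta> is carried along, because the induction splits
    \<alpha> into summands and each is built on top of the previous ones.\<close>
  have "P \<beta> \<Longrightarrow> P (\<alpha> + \<beta>)" for \<beta>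
  proof (induction \<alpha> arbitrary: \<beta> rule: poly_mapping_single_add_induct)
    case (single i k)
    show ?case
    proof (induction k)
      case (Suc k)
      have "Poly_Mapping.single i (Suc k) + \<beta> =
          Poly_Mapping.single i 1 + (Poly_Mapping.single i k + \<beta>)"
        by (simp add: single_add[symmetric] add.assoc[symmetric])
      then show ?case using step[OF Suc] by simp
    qed (use single in simp)
  qed (simp add: add.assoc)
  from this[of 0] show ?thesis using zero by simp
qed

lemma px_mult_single:
  "px i * Poly_Mapping.single \<alpha> a = Poly_Mapping.single (Poly_Mapping.single i 1 + \<alpha>) a"
  by (simp add: px_def mult_single)

text \<open>The induction that fits twisted Leibniz rules: one variable at a time, with the
  constants as base.\<close>

lemma poly_induct [case_names const px add]:
  fixes f :: "'n poly_ring"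
  assumes const: "\<And>a. P (const a)" and px: "\<And>i f. P f \<Longrightarrow> P (px i * f)"
    and add: "\<And>f g. P f \<Longrightarrow> P g \<Longrightarrow> P (f + g)"
  shows "P f"
proof (induction f rule: poly_mapping_single_add_induct)
  case (single \<alpha> a)
  show ?case
  proof (induction \<alpha> rule: monomial_induct)
    case zero show ?case using const[of a] by (simp add: const_def)
  next
    case (step i \<alpha>)
    show ?case using px[OF step, of i] by (simp add: px_mult_single)
  qed
qed (rule add)

lemma const_add: "const (a + b) = const a + const b"
  by (simp add: const_def single_add)

lemma const_mult: "const (a * b) = const a * const b"
  by (simp add: const_def mult_single)

lemma poly_act_eq_pm_extend: "poly_act w = pm_extend (\<lambda>\<alpha> z. const z *
    (\<Prod>i\<in>UNIV. (of_int (wsign w i) * px (wperm w i)) ^ Poly_Mapping.lookup \<alpha> i))"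
  by (simp add: poly_act_def pm_extend_def fun_eq_iff)

lemma poly_act_additive: "additive (poly_act w)"
  unfolding poly_act_eq_pm_extend
  by (intro additive_pm_extend) (simp add: additive_def const_add distrib_right)

lemmas poly_act_add = additive.add[OF poly_act_additive]

lemma poly_act_single: "poly_act w (Poly_Mapping.single \<alpha> a) = const a *
    (\<Prod>i\<in>UNIV. (of_int (wsign w i) * px (wperm w i)) ^ Poly_Mapping.lookup \<alpha> i)"
  unfolding poly_act_eq_pm_extend by (rule pm_extend_single) (simp add: const_def)

lemma poly_act_const [simp]: "poly_act w (const a) = const a"
  unfolding const_def by (simp add: poly_act_single) (simp add: const_def)

lemma poly_act_px_mult:
  "poly_act w (px i * f) = of_int (wsign w i) * px (wperm w i) * poly_act w f"
proof (induction f rule: poly_mapping_single_add_induct)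
  case (single \<alpha> a)
  let ?x = "\<lambda>j. of_int (wsign w j) * px (wperm w j)"
  have "(\<Prod>j\<in>UNIV. ?x j ^ Poly_Mapping.lookup (Poly_Mapping.single i 1 + \<alpha>) j)
      = (\<Prod>j\<in>UNIV. (if j = i then ?x i else 1) * ?x j ^ Poly_Mapping.lookup \<alpha> j)"
    by (intro prod.cong) (auto simp: lookup_add lookup_single when_def)
  also have "\<dots> = ?x i * (\<Prod>j\<in>UNIV. ?x j ^ Poly_Mapping.lookup \<alpha> j)"
    by (simp add: prod.distrib)
  finally show ?case by (simp add: px_mult_single poly_act_single mult.assoc mult.left_commute)
qed (simp add: poly_act_add distrib_left)

lemma poly_act_const_mult: "poly_act w (const a * f) = const a * poly_act w f"
proof (induction f rule: poly_induct)
  case (const b)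
  show ?case by (simp flip: const_mult)
next
  case (px i f)
  then show ?case by (simp add: poly_act_px_mult mult.left_commute[of "const a"])
qed (simp add: poly_act_add distrib_left)

section \<open>Divided differences\<close>

lemma lookup_px: "Poly_Mapping.lookup (px i) (Poly_Mapping.single j 1) = (if i = j then 1 else 0)"
  by (auto simp: px_def lookup_single when_def dest: arg_cong[of _ _ Poly_Mapping.keys])

lemma px_diff_nonzero: "i \<noteq> k \<Longrightarrow> px i - px k \<noteq> 0"
  using lookup_px[of i i] lookup_px[of k i]
  by (metis lookup_minus lookup_zero diff_zero zero_neq_one)

text \<open>The coefficient of x_i is 1, or 2 when i = k; characteristic 0 covers the second
  case.\<close>

lemma px_add_nonzero: "px i + px k \<noteq> 0"
proof
  assume "px i + px k = 0"
  then have "Poly_Mapping.lookup (px i + px k) (Poly_Mapping.single i 1) = 0" by simp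
  then show False using lookup_px[of i i] lookup_px[of k i]
    by (simp add: lookup_add split: if_splits)
qed

text \<open>The polynomial ring is an integral domain, so a quotient by a nonzero d is unique and
  the definite description denotes it.\<close>

lemma poly_quot_eq:
  fixes d :: "'n::{finite,linorder} poly_ring"
  shows "d \<noteq> 0 \<Longrightarrow> q * d = f \<Longrightarrow> poly_quot f d = q"
  unfolding poly_quot_def by (rule the_equality) auto

text \<open>Divisibility follows from x_j f - (x_j f)^s = x_j (f - f^s) + (x_j - x_j^s) f^s, where
  x_j - x_j^s is itself a multiple of x_i - x_k.\<close>

lemma refl_quot_exists:
  assumes "i \<noteq> k"
  shows "\<exists>q. q * (px i - px k) = f - poly_act (s_refl k i) f"
proof (induction f rule: poly_induct)
  case (const a)
  show ?case by (intro exI[of _ 0]) simp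
next
  case (px j f)
  then obtain q where q: "q * (px i - px k) = f - poly_act (s_refl k i) f" by blast
  \<comment> \<open>This is (x_j - x_j^s) / (x_i - x_k).\<close>
  let ?r = "if j = i then 1 else if j = k then - 1 else 0"
  have "(px j * q + ?r * poly_act (s_refl k i) f) * (px i - px k)
      = px j * (q * (px i - px k)) + ?r * poly_act (s_refl k i) f * (px i - px k)"
    by (simp only: distrib_right mult.assoc)
  also have "\<dots> = px j * f - poly_act (s_refl k i) (px j * f)"
    unfolding q poly_act_px_mult using assms by (auto simp: algebra_simps)
  finally show ?case by blast
next
  case (add f g)
  then obtain q r where "q * (px i - px k) = f - poly_act (s_refl k i) f"
    "r * (px i - px k) = g - poly_act (s_refl k i) g" by blast
  then have "(q + r) * (px i - px k) = f + g - poly_act (s_refl k i) (f + g)"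
    by (simp only: distrib_right poly_act_add) simp
  then show ?case by blast
qed

lemma bar_refl_quot_exists:
  assumes "i \<noteq> k"
  shows "\<exists>q. q * (px i + px k) = f - poly_act (sbar_refl k i) f"
proof (induction f rule: poly_induct)
  case (const a)
  show ?case by (intro exI[of _ 0]) simp
next
  case (px j f)
  then obtain q where q: "q * (px i + px k) = f - poly_act (sbar_refl k i) f" by blast
  \<comment> \<open>This is (x_j - x_j^sbar) / (x_i + x_k). Both j = i and j = k give the numerator
    x_i + x_k, so no minus sign occurs.\<close>
  let ?r = "if j = i \<or> j = k then 1 else 0"
  have "(px j * q + ?r * poly_act (sbar_refl k i) f) * (px i + px k)
      = px j * (q * (px i + px k)) + ?r * poly_act (sbar_refl k i) f * (px i + px k)"
    by (simp only: distrib_right mult.assoc)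
  also have "\<dots> = px j * f - poly_act (sbar_refl k i) (px j * f)"
    unfolding q poly_act_px_mult using assms by (auto simp: algebra_simps)
  finally show ?case by blast
next
  case (add f g)
  then obtain q r where "q * (px i + px k) = f - poly_act (sbar_refl k i) f"
    "r * (px i + px k) = g - poly_act (sbar_refl k i) g" by blast
  then have "(q + r) * (px i + px k) = f + g - poly_act (sbar_refl k i) (f + g)"
    by (simp only: distrib_right poly_act_add) simp
  then show ?case by blast
qed

context
  fixes i k :: "'n::{finite,linorder}"
  assumes ik: "i \<noteq> k"
begin

lemma ddiff_mult: "ddiff i k f * (px i - px k) = f - poly_act (s_refl k i) f"
  using refl_quot_exists[OF ik, of f] poly_quot_eq[OF px_diff_nonzero[OF ik]]
  unfolding ddiff_def by metis

lemma ddiff_bar_mult: "ddiff_bar i k f * (px i + px k) = f - poly_act (sbar_refl k i) f"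
  using bar_refl_quot_exists[OF ik, of f] poly_quot_eq[OF px_add_nonzero[of i k]]
  unfolding ddiff_bar_def by metis

lemma ddiff_eqI: "q * (px i - px k) = f - poly_act (s_refl k i) f \<Longrightarrow> ddiff i k f = q"
  unfolding ddiff_def using poly_quot_eq[OF px_diff_nonzero[OF ik]] by metis

lemma ddiff_bar_eqI: "q * (px i + px k) = f - poly_act (sbar_refl k i) f \<Longrightarrow> ddiff_bar i k f = q"
  unfolding ddiff_bar_def using poly_quot_eq[OF px_add_nonzero[of i k]] by metis

lemma ddiff_add: "ddiff i k (f + g) = ddiff i k f + ddiff i k g"
  by (rule ddiff_eqI) (simp only: distrib_right ddiff_mult poly_act_add, simp)

lemma ddiff_bar_add: "ddiff_bar i k (f + g) = ddiff_bar i k f + ddiff_bar i k g"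
  by (rule ddiff_bar_eqI) (simp only: distrib_right ddiff_bar_mult poly_act_add, simp)

lemma ddiff_const_mult: "ddiff i k (const a * f) = const a * ddiff i k f"
  by (rule ddiff_eqI)
    (simp only: mult.assoc ddiff_mult poly_act_const_mult, simp add: right_diff_distrib)

lemma ddiff_bar_const_mult: "ddiff_bar i k (const a * f) = const a * ddiff_bar i k f"
  by (rule ddiff_bar_eqI)
    (simp only: mult.assoc ddiff_bar_mult poly_act_const_mult, simp add: right_diff_distrib)

lemma ddiff_const [simp]: "ddiff i k (const a) = 0"
  by (rule ddiff_eqI) simp

lemma ddiff_bar_const [simp]: "ddiff_bar i k (const a) = 0"
  by (rule ddiff_bar_eqI) simp

text \<open>The correction is the divided difference of x_j times f^s. In \<open>dunkl\<close> these
  corrections add up to the commutator with x_j.\<close>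

lemma ddiff_px_mult: "ddiff i k (px j * f) = px j * ddiff i k f +
    (if j = i then poly_act (s_refl k i) f else if j = k then - poly_act (s_refl k i) f else 0)"
proof (rule ddiff_eqI)
  have "px j * ddiff i k f * (px i - px k) = px j * (f - poly_act (s_refl k i) f)"
    by (simp only: mult.assoc ddiff_mult)
  then show "(px j * ddiff i k f + (if j = i then poly_act (s_refl k i) f
      else if j = k then - poly_act (s_refl k i) f else 0)) * (px i - px k)
      = px j * f - poly_act (s_refl k i) (px j * f)"
    using ik by (simp only: distrib_right poly_act_px_mult) (auto simp: algebra_simps)
qed

lemma ddiff_bar_px_mult: "ddiff_bar i k (px j * f) = px j * ddiff_bar i k f +
    (if j = i \<or> j = k then poly_act (sbar_refl k i) f else 0)"
proof (rule ddiff_bar_eqI)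
  have "px j * ddiff_bar i k f * (px i + px k) = px j * (f - poly_act (sbar_refl k i) f)"
    by (simp only: mult.assoc ddiff_bar_mult)
  then show "(px j * ddiff_bar i k f + (if j = i \<or> j = k then poly_act (sbar_refl k i) f else 0))
      * (px i + px k) = px j * f - poly_act (sbar_refl k i) (px j * f)"
    using ik by (simp only: distrib_right poly_act_px_mult) (auto simp: algebra_simps)
qed

end

section \<open>Relations between Dunkl operators\<close>

text \<open>Multiplication by a sign on a bare abelian group; the integer e is always 1 or -1 in the
  applications.\<close>

definition signed :: "int \<Rightarrow> 'a \<Rightarrow> 'a::ab_group_add" where
  "signed e t = (if e = 1 then t else - t)"

lemma signed_1 [simp]: "signed 1 t = t" and signed_m1 [simp]: "signed (-1) t = - t"
  by (simp_all add: signed_def)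

text \<open>Kept apart from the representation so that \<open>D\<close> can be used in the axioms of
  \<open>dunkl_rep\<close>, and in the Leibniz rule of the concrete operators before those axioms
  are verified.\<close>

locale commutator_ops =
  fixes u :: complex
    and S :: "complex \<Rightarrow> 'p::ab_group_add \<Rightarrow> 'p"
    and C :: "'n::finite \<Rightarrow> 'p \<Rightarrow> 'p"
    and G :: "'n weyl_D \<Rightarrow> 'p \<Rightarrow> 'p"
begin

text \<open>\<open>A j i\<close> is the action of (1 + c_j c_i) s_ji and \<open>B j i\<close> that
  of (1 - c_j c_i) sbar_ji, the two elements from which all commutators are built.\<close>

definition A where "A j i t = G (s_refl j i) t + C j (C i (G (s_refl j i) t))"

definition B where "B j i t = G (sbar_refl j i) t - C j (C i (G (sbar_refl j i) t))"

text \<open>The prescribed value of the commutator \<open>[y\<^sub>i, x\<^sub>j]\<close>.\<close>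

definition D where
  "D i j t = (if i = j then - S u (\<Sum>k\<in>UNIV - {i}. A k i t + B k i t)
              else S u (A i j t - B i j t))"

end

text \<open>The module is generated by the \<open>x\<^sub>i\<close> from the image of \<open>inc\<close>, so every relation not assumed
  here, in particular \<open>y\<^sub>i y\<^sub>j = y\<^sub>j y\<^sub>i\<close>, follows by induction from the commutation rules
  with the \<open>x\<^sub>i\<close> and the action on that image.\<close>

locale dunkl_rep = commutator_ops u S C G
  for u :: complex
    and S :: "complex \<Rightarrow> 'p::ab_group_add \<Rightarrow> 'p"
    and C :: "'n::finite \<Rightarrow> 'p \<Rightarrow> 'p"
    and G :: "'n weyl_D \<Rightarrow> 'p \<Rightarrow> 'p" +
  fixes S0 :: "complex \<Rightarrow> 'm::ab_group_add \<Rightarrow> 'm"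
    and C0 :: "'n \<Rightarrow> 'm \<Rightarrow> 'm"
    and G0 :: "'n weyl_D \<Rightarrow> 'm \<Rightarrow> 'm"
    and inc :: "'m \<Rightarrow> 'p"
    and Mx :: "'n \<Rightarrow> 'p \<Rightarrow> 'p"
    and Y :: "'n \<Rightarrow> 'p \<Rightarrow> 'p"
  assumes C0_sq: "C0 i (C0 i m) = m"
    and C0_anti: "i \<noteq> j \<Longrightarrow> C0 i (C0 j m) = - C0 j (C0 i m)"
    and G0_one: "G0 1 m = m"
    and G0_mult: "G0 w (G0 v m) = G0 (w * v) m"
    and G0_C0: "G0 w (C0 i m) = signed (wsign w i) (C0 (wperm w i) (G0 w m))"
    and S0_add: "S0 (a + b) m = S0 a m + S0 b m"
    and S0_mult: "S0 (a * b) m = S0 a (S0 b m)"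
    and S0_one: "S0 1 m = m"
    and C0_S0: "C0 i (S0 a m) = S0 a (C0 i m)"
    and G0_S0: "G0 w (S0 a m) = S0 a (G0 w m)"
    and additive: "additive inc" "additive (S a)" "additive (Mx i)" "additive (C i)"
      "additive (G w)" "additive (Y i)"
    and X_induct: "(\<And>m. Q (inc m)) \<Longrightarrow> (\<And>i t. Q t \<Longrightarrow> Q (Mx i t)) \<Longrightarrow>
      (\<And>s t. Q s \<Longrightarrow> Q t \<Longrightarrow> Q (s + t)) \<Longrightarrow> Q t"
    and X_X: "Mx i (Mx j t) = Mx j (Mx i t)"
    and S_inc: "S a (inc m) = inc (S0 a m)"
    and C_inc: "C i (inc m) = inc (C0 i m)"
    and G_inc: "G w (inc m) = inc (G0 w m)"
    and Y_inc: "Y i (inc m) = 0"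
    and S_X: "S a (Mx i t) = Mx i (S a t)"
    and C_X: "C i (Mx j t) = (if i = j then - Mx j (C i t) else Mx j (C i t))"
    and G_X: "G w (Mx i t) = signed (wsign w i) (Mx (wperm w i) (G w t))"
    and Y_X: "Y i (Mx j t) = Mx j (Y i t) + D i j t"
begin

lemmas linear [simp] = additive[THEN additive.add] additive[THEN additive.minus]
  additive[THEN additive.diff] additive[THEN additive.zero]

lemmas [simp] = S_X G_X C_X Y_X S_inc C_inc G_inc Y_inc

lemma X_rec [case_names inc Mx add]:
  "(\<And>m. Q (inc m)) \<Longrightarrow> (\<And>i t. Q t \<Longrightarrow> Q (Mx i t)) \<Longrightarrow>
      (\<And>s t. Q s \<Longrightarrow> Q t \<Longrightarrow> Q (s + t)) \<Longrightarrow> Q t"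
  by (rule X_induct)

lemma linear_signed [simp]:
  "S a (signed e t) = signed e (S a t)" "Mx i (signed e t) = signed e (Mx i t)"
  "C i (signed e t) = signed e (C i t)" "G w (signed e t) = signed e (G w t)"
  "Y i (signed e t) = signed e (Y i t)" "inc (signed e m) = signed e (inc m)"
  by (simp_all add: signed_def)

section \<open>Relations of K, lifted from the constants\<close>

lemma S_add_left: "S (a + b) t = S a t + S b t"
  by (induction t rule: X_rec) (simp_all add: S0_add)

lemma S_mult: "S (a * b) t = S a (S b t)"
  by (induction t rule: X_rec) (simp_all add: S0_mult)

lemma S_one: "S 1 t = t"
  by (induction t rule: X_rec) (simp_all add: S0_one)

lemma C_S: "C i (S a t) = S a (C i t)"
  by (induction t rule: X_rec) (auto simp: C0_S0)

lemma G_S: "G w (S a t) = S a (G w t)"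
  by (induction t rule: X_rec) (simp_all add: G0_S0)

lemma C_sq: "C i (C i t) = t"
  by (induction t rule: X_rec) (auto simp: C0_sq)

lemma C_anti: "i \<noteq> j \<Longrightarrow> C i (C j t) = - C j (C i t)"
proof (induction t rule: X_rec)
  case (inc m)
  then show ?case using C0_anti[of i j m] by simp
qed auto

lemma G_one: "G 1 t = t"
  by (induction t rule: X_rec) (simp_all add: G0_one)

lemma G_mult: "G w (G v t) = G (w * v) t"
proof (induction t rule: X_rec)
  case (Mx i t)
  then show ?case
    using wsign_cases[of v i] wsign_cases[of w "wperm v i"] by auto
qed (simp_all add: G0_mult)

lemma G_C: "G w (C i t) = signed (wsign w i) (C (wperm w i) (G w t))"
proof (induction t rule: X_rec)
  case (Mx j t)
  then show ?case
    using wsign_cases[of w i] wsign_cases[of w j] by auto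
qed (simp_all add: G0_C0, simp add: signed_def)

section \<open>Moving scalars, c, w and y past the commutators\<close>

lemma A_S: "A j i (S a t) = S a (A j i t)" and B_S: "B j i (S a t) = S a (B j i t)"
  by (simp_all add: A_def B_def C_S G_S)

lemma S_S: "S a (S b t) = S b (S a t)"
  by (simp flip: S_mult add: mult.commute)

lemma S_sum: "S a (\<Sum>k\<in>K. f k) = (\<Sum>k\<in>K. S a (f k))"
  by (rule additive.sum[OF additive(2)])

lemma D_S: "D i j (S a t) = S a (D i j t)"
  by (simp add: D_def A_S B_S S_S[of u a] flip: S_sum linear)

lemma Y_S: "Y i (S a t) = S a (Y i t)"
  by (induction t rule: X_rec) (simp_all add: D_S)

text \<open>Only c_i changes the sign: c_i (1 + c_j c_i) s = (c_i - c_j) s = - (1 + c_j c_i) s c_i,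
  while the same computation with c_j gives a plus. The asymmetry mirrors x_i, which anticommutes
  with c_i alone: as the y commute with every c, a commutator with x_i must inherit its
  sign.\<close>

lemma C_A: "j \<noteq> i \<Longrightarrow> C l (A j i t) = (if l = i then - A j i (C l t) else A j i (C l t))"
  using C_anti[of i j] C_anti[of l i] C_anti[of l j]
  by (cases "l = i"; cases "l = j") (simp_all add: A_def G_C C_sq)

lemma C_B: "j \<noteq> i \<Longrightarrow> C l (B j i t) = (if l = i then - B j i (C l t) else B j i (C l t))"
  using C_anti[of i j] C_anti[of l i] C_anti[of l j]
  by (cases "l = i"; cases "l = j") (simp_all add: B_def G_C C_sq)

lemma C_D: "C l (D i j t) = (if l = j then - D i j (C l t) else D i j (C l t))"
proof (cases "i = j")
  case True
  have "C l (\<Sum>k\<in>UNIV - {j}. A k j t + B k j t)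
      = (\<Sum>k\<in>UNIV - {j}. C l (A k j t + B k j t))"
    by (rule additive.sum[OF additive(4)])
  also have "\<dots> = (if l = j then - (\<Sum>k\<in>UNIV - {j}. A k j (C l t) + B k j (C l t))
      else (\<Sum>k\<in>UNIV - {j}. A k j (C l t) + B k j (C l t)))"
    by (auto simp: C_A C_B simp flip: sum_negf intro!: sum.cong)
  finally show ?thesis using True by (simp add: D_def C_S)
qed (simp add: D_def C_S C_A C_B)

lemma Y_C: "Y i (C j t) = C j (Y i t)"
  by (induction t rule: X_rec) (auto simp: C_D)

text \<open>If w has opposite signs on i and j, then c_j c_i acquires a minus sign and s_ji is
  conjugated to a reflection of type sbar, which together give \<open>B\<close>.\<close>

lemma G_A: "j \<noteq> i \<Longrightarrow> G w (A j i t) =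
    (if wsign w i = wsign w j then A (wperm w j) (wperm w i) (G w t)
     else B (wperm w j) (wperm w i) (G w t))"
  using wsign_cases[of w i] wsign_cases[of w j]
  by (auto simp: A_def B_def G_C G_mult weyl_D_mult_s_refl)

lemma G_B: "j \<noteq> i \<Longrightarrow> G w (B j i t) =
    (if wsign w i = wsign w j then B (wperm w j) (wperm w i) (G w t)
     else A (wperm w j) (wperm w i) (G w t))"
  using wsign_cases[of w i] wsign_cases[of w j]
  by (auto simp: A_def B_def G_C G_mult weyl_D_mult_sbar_refl)

text \<open>When w has opposite signs on the two indices involved, \<open>A\<close> and
  \<open>B\<close> change places. The off-diagonal difference then changes sign, whereas the
  diagonal sum is only reindexed.\<close>

lemma G_D: "G w (D i j t) = signed (wsign w i * wsign w j) (D (wperm w i) (wperm w j) (G w t))"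
proof (cases "i = j")
  case True
  have "bij_betw (wperm w) (UNIV - {j}) (UNIV - {wperm w j})"
    using bij_betw_DiffI[OF bij_wperm, of w "{j}" "{wperm w j}"] by simp
  then have "(\<Sum>k\<in>UNIV - {wperm w j}. A k (wperm w j) (G w t) + B k (wperm w j) (G w t))
      = (\<Sum>k\<in>UNIV - {j}. A (wperm w k) (wperm w j) (G w t) + B (wperm w k) (wperm w j) (G w t))"
    by (rule sum.reindex_bij_betw[symmetric])
  also have "\<dots> = G w (\<Sum>k\<in>UNIV - {j}. A k j t + B k j t)"
    unfolding additive.sum[OF additive(5)]
    by (intro sum.cong) (auto simp: G_A G_B)
  finally show ?thesis
    using True wsign_cases[of w j] by (auto simp: D_def G_S)
next
  case False
  then show ?thesis
    using wsign_cases[of w i] wsign_cases[of w j] by (auto simp: D_def G_S G_A G_B)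
qed

lemma G_Y: "G w (Y i t) = signed (wsign w i) (Y (wperm w i) (G w t))"
proof (induction t rule: X_rec)
  case (Mx j t)
  then show ?case
    using wsign_cases[of w i] wsign_cases[of w j] by (auto simp: G_D)
qed (simp_all, simp_all add: signed_def)

text \<open>Since y commutes with c_j c_i, only the reflection acts on its index; the transposition
  is its own inverse.\<close>

lemma Y_A: "Y l (A j i t) = A j i (Y (transpose j i l) t)"
  using G_Y[of "s_refl j i" "transpose j i l" t] by (simp add: A_def Y_C)

lemma Y_B: "j \<noteq> i \<Longrightarrow> Y l (B j i t) =
    (if l \<in> {i, j} then - B j i (Y (transpose j i l) t) else B j i (Y (transpose j i l) t))"
  using G_Y[of "sbar_refl j i" "transpose j i l" t] by (auto simp: B_def Y_C)

text \<open>In the sum for [y_j, x_j] only the reflections with k = i move y_i; all other terms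
  commute with it. The subtracted bracket is the discrepancy caused by this one index.\<close>

lemma Y_D_diag:
  assumes "i \<noteq> j"
  shows "Y i (D j j t) = D j j (Y i t) -
    S u (A i j (Y j t) - B i j (Y j t) - (A i j (Y i t) + B i j (Y i t)))"
proof -
  have *: "(\<Sum>k\<in>UNIV - {j}. f k) = f i + (\<Sum>k\<in>UNIV - {j} - {i}. f k)" for f :: "'n \<Rightarrow> 'p"
    using assms by (intro sum.remove) auto
  have "Y i (\<Sum>k\<in>UNIV - {j} - {i}. A k j t + B k j t)
      = (\<Sum>k\<in>UNIV - {j} - {i}. A k j (Y i t) + B k j (Y i t))"
    unfolding additive.sum[OF additive(6)] using assms
    by (intro sum.cong) (auto simp: Y_A Y_B)
  then show ?thesis using assms by (simp add: D_def * Y_S Y_A Y_B)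
qed

text \<open>The terms left over when y_i y_j and y_j y_i are moved past x_k. For k different from i
  and j they match in pairs, because the reflections in [y_j, x_k] fix y_i and those in [y_i, x_k]
  fix y_j. Otherwise the bracket in \<open>Y_D_diag\<close> accounts exactly for the off-diagonal
  commutators.\<close>

lemma Y_D:
  assumes "i \<noteq> j"
  shows "D i k (Y j t) + Y i (D j k t) = D j k (Y i t) + Y j (D i k t)"
proof -
  consider "k = j" | "k = i" | "k \<noteq> i" "k \<noteq> j" by blast
  then show ?thesis
  proof cases
    case 1
    then show ?thesis using assms
      by (simp add: Y_D_diag) (simp add: D_def Y_S Y_A Y_B)
  next
    case 2
    then show ?thesis using assms
      by (simp add: Y_D_diag) (simp add: D_def Y_S Y_A Y_B)
  next
    case 3
    then show ?thesis using assms by (simp add: D_def Y_S Y_A Y_B)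
  qed
qed

lemma Y_Y: "Y i (Y j t) = Y j (Y i t)"
proof (cases "i = j")
  case False
  show ?thesis
  proof (induction t rule: X_rec)
    case (Mx k t)
    then show ?case using Y_D[OF False, of k t] by (simp add: add.assoc)
  qed simp_all
qed simp

section \<open>The resulting representation of the presented algebra\<close>

definition E :: "'n H_gen \<Rightarrow> 'p \<Rightarrow> 'p" where
  "E g = (case g of HX i \<Rightarrow> Mx i | HY i \<Rightarrow> Y i | HC i \<Rightarrow> C i | HW w \<Rightarrow> G w)"

lemma E_simps [simp]: "E (HX i) = Mx i" "E (HY i) = Y i" "E (HC i) = C i" "E (HW w) = G w"
  by (simp_all add: E_def)

lemma E_additive: "additive (E g)"
  by (cases g) (simp_all add: additive)

lemma E_S: "E g (S a t) = S a (E g t)"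
  by (cases g) (simp_all add: C_S G_S Y_S)

sublocale free_alg_rep S E
  by unfold_locales
    (simp_all only: additive.add[OF E_additive] linear S_add_left S_mult S_one E_S)

lemma ev_wsign: "ev (of_int (wsign w i)) t = signed (wsign w i) t"
  using wsign_cases[of w i] by (auto simp: ev_minus ev_one)

lemma ev_D:
  assumes "i \<noteq> j"
  shows "ev (const u * ((1 + gen (HC j) * gen (HC i)) * gen (HW (s_refl i j))
      - (1 - gen (HC j) * gen (HC i)) * gen (HW (sbar_refl i j)))) t = D j i t"
  using assms
  by (simp add: D_def A_def B_def ev_mult ev_add ev_diff ev_const ev_gen ev_one
      s_refl_commute[of j i] sbar_refl_commute[of j i])

lemma ev_D_diag:
  "ev (const u * (\<Sum>k\<in>UNIV - {i}. (1 + gen (HC k) * gen (HC i)) * gen (HW (s_refl k i))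
      + (1 - gen (HC k) * gen (HC i)) * gen (HW (sbar_refl k i)))) t = - D i i t"
  by (simp add: D_def A_def B_def ev_mult ev_add ev_diff ev_sum ev_const ev_gen ev_one)

lemma ev_H_rels: "r \<in> H_rels u \<Longrightarrow> ev r t = 0"
proof -
  note ev = ev_mult ev_add ev_diff ev_minus ev_gen ev_one ev_wsign
  have w: "G w (G v t) = t" if "w * v = 1" for w v t using that by (simp add: G_mult G_one)
  have c: "C i (C j t) + C j (C i t) = 0" if "i \<noteq> j" for i j t using C_anti[OF that, of t] by simp
  show "r \<in> H_rels u \<Longrightarrow> ev r t = 0"
    unfolding H_rels_def K_relations_def Let_def Un_iff mem_Collect_eq singleton_iff
    \<comment> \<open>The commutator relations are evaluated while their long factor is intact; once
      the general rules have split the products, \<open>ev_D\<close> and \<open>ev_D_diag\<close> no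
      longer match.\<close>
    apply (elim disjE exE conjE; simp only: ev_diff ev_add ev_D ev_D_diag not_False_eq_True)
    apply (simp_all add: ev C_sq G_one G_mult X_X Y_Y Y_C G_C G_Y w c)
    done
qed

end

section \<open>Dunkl operators on polynomials with coefficients in a module\<close>

text \<open>The inverse of (p, \<epsilon>) has the permutation p^-1 and the sign \<epsilon> (p^-1 i)
  at i. Its minus signs sit at the p-image of those of w, so their number stays even.\<close>

lemma weyl_D_inverse: "\<exists>v :: 'n::finite weyl_D. v * w = 1 \<and> w * v = 1"
proof -
  let ?q = "inv_into UNIV (wperm w)"
  have q [simp]: "?q (wperm w i) = i" "wperm w (?q i) = i" for i
    using bij_wperm[of w] by (simp_all add: bij_is_inj bij_is_surj surj_f_inv_f)
  have "{i. wsign w (?q i) = -1} = wperm w ` {i. wsign w i = -1}"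
    by (auto intro!: image_eqI[of _ _ "?q _"])
  then have "card {i. wsign w (?q i) = -1} = card {i. wsign w i = -1}"
    by (simp add: card_image[OF inj_on_subset[OF bij_is_inj[OF bij_wperm] subset_UNIV]])
  moreover have "even (card {i. wsign w i = -1})" by transfer auto
  moreover have "range (\<lambda>i. wsign w (?q i)) \<subseteq> {1, -1}" using wsign_cases[of w] by auto
  ultimately have "(?q, \<lambda>i. wsign w (?q i)) \<in>
      {(p, \<epsilon>). bij p \<and> range \<epsilon> \<subseteq> {1, -1} \<and> even (card {i. \<epsilon> i = -1})}"
    using bij_imp_bij_inv[OF bij_wperm[of w]] by simp
  then have v: "wperm (Abs_weyl_D (?q, \<lambda>i. wsign w (?q i))) = ?q"
    "wsign (Abs_weyl_D (?q, \<lambda>i. wsign w (?q i))) = (\<lambda>i. wsign w (?q i))"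
    by (simp_all only: wperm.rep_eq wsign.rep_eq Abs_weyl_D_inverse fst_conv snd_conv)
  have "wsign w i * wsign w i = 1" for i using wsign_cases[of w i] by auto
  then show ?thesis
    by (intro exI[of _ "Abs_weyl_D (?q, \<lambda>i. wsign w (?q i))"] conjI weyl_D_eqI) (simp_all add: v)
qed

section \<open>The action of K on M\<close>

locale K_module =
  fixes u :: complex
    and act :: "'n::{finite,linorder} K_gen free_alg set \<Rightarrow> 'm::ab_group_add \<Rightarrow> 'm"
  assumes left_module_act: "left_module K_alg act"
begin

definition scal0 :: "complex \<Rightarrow> 'm \<Rightarrow> 'm" where "scal0 a = act (cls K_rels (const a))"

definition cl0 :: "'n \<Rightarrow> 'm \<Rightarrow> 'm" where "cl0 i = act (cls K_rels (gen (KC i)))"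

definition wg0 :: "'n weyl_D \<Rightarrow> 'm \<Rightarrow> 'm" where "wg0 w = act (cls K_rels (gen (KW w)))"

lemma left_module_presented: "left_module (presented K_rels) act"
  using left_module_act by (simp add: K_alg_def)

lemmas act_mult = act_cls_mult[OF left_module_presented]
  and act_add_left = act_cls_add_left[OF left_module_presented]
  and act_minus_left = additive.minus[OF act_cls_additive_left[OF left_module_presented]]
  and act_one = act_cls_one[OF left_module_presented]
  and act_eq_rel = act_cls_eq_rel[OF left_module_presented]

lemma scal0_additive: "additive (scal0 a)" and cl0_additive: "additive (cl0 i)"
  and wg0_additive: "additive (wg0 w)"
  unfolding scal0_def cl0_def wg0_def by (rule act_cls_additive[OF left_module_presented])+

lemmas linear0 [simp] =
  scal0_additive[THEN additive.add] scal0_additive[THEN additive.minus]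
  scal0_additive[THEN additive.diff] scal0_additive[THEN additive.zero]
  cl0_additive[THEN additive.add] cl0_additive[THEN additive.minus]
  cl0_additive[THEN additive.diff] cl0_additive[THEN additive.zero]
  wg0_additive[THEN additive.add] wg0_additive[THEN additive.minus]
  wg0_additive[THEN additive.diff] wg0_additive[THEN additive.zero]

lemma scal0_add_left: "scal0 (a + b) m = scal0 a m + scal0 b m"
  by (simp add: scal0_def const_add act_add_left)

lemma scal0_additive_left: "additive (\<lambda>a. scal0 a m)"
  by (simp add: additive_def scal0_add_left)

lemmas [simp] = additive.zero[OF scal0_additive_left]

lemma scal0_mult: "scal0 (a * b) m = scal0 a (scal0 b m)"
  by (simp add: scal0_def const_mult act_mult)

lemma scal0_one [simp]: "scal0 1 m = m"
  using act_one[of m] by (simp add: scal0_def const_def)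

lemma const_gen_commute: "const a * gen g = gen g * const a"
  by (simp add: const_def gen_def mult_single)

lemma cl0_scal0: "cl0 i (scal0 a m) = scal0 a (cl0 i m)"
  by (simp add: scal0_def cl0_def const_gen_commute flip: act_mult)

lemma wg0_scal0: "wg0 w (scal0 a m) = scal0 a (wg0 w m)"
  by (simp add: scal0_def wg0_def const_gen_commute flip: act_mult)

lemma cl0_sq: "cl0 i (cl0 i m) = m"
  unfolding cl0_def act_mult[symmetric]
  by (rule trans[OF act_eq_rel act_one]) (auto simp: K_rels_def K_relations_def)

lemma cl0_anti: "i \<noteq> j \<Longrightarrow> cl0 i (cl0 j m) = - cl0 j (cl0 i m)"
  unfolding cl0_def act_mult[symmetric] act_minus_left[symmetric]
  by (rule act_eq_rel) (auto simp: K_rels_def K_relations_def)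

lemma wg0_one: "wg0 1 m = m"
  unfolding wg0_def
  by (rule trans[OF act_eq_rel act_one]) (auto simp: K_rels_def K_relations_def)

lemma wg0_mult: "wg0 w (wg0 v m) = wg0 (w * v) m"
  unfolding wg0_def act_mult[symmetric]
  by (rule act_eq_rel) (auto simp: K_rels_def K_relations_def)

lemma wg0_cl0: "wg0 w (cl0 i m) = signed (wsign w i) (cl0 (wperm w i) (wg0 w m))"
proof -
  obtain v where v: "v * w = 1" "w * v = 1" using weyl_D_inverse by blast
  \<comment> \<open>The relation is a conjugation, so m is replaced by v w m, which puts the inverse
    v of w to the right of c_i.\<close>
  have "wg0 w (cl0 i (wg0 v (wg0 w m)))
      = act (cls K_rels (gen (KW w) * gen (KC i) * gen (KW v))) (wg0 w m)"
    by (simp add: wg0_def cl0_def act_mult)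
  also have "\<dots> = act (cls K_rels (of_int (wsign w i) * gen (KC (wperm w i)))) (wg0 w m)"
    by (rule act_eq_rel) (use v in \<open>auto simp: K_rels_def K_relations_def\<close>)
  also have "\<dots> = signed (wsign w i) (cl0 (wperm w i) (wg0 w m))"
    using wsign_cases[of w i] by (auto simp: act_minus_left cl0_def)
  finally show ?thesis by (simp add: wg0_mult v wg0_one)
qed

section \<open>Operators on polynomials with coefficients in M\<close>

abbreviation scal :: "complex \<Rightarrow> ('n, 'm) poly_tensor \<Rightarrow> ('n, 'm) poly_tensor" where
  "scal \<equiv> tensor_scale act"

abbreviation pt :: "'n poly_ring \<Rightarrow> 'm \<Rightarrow> ('n, 'm) poly_tensor" where
  "pt \<equiv> pure_tensor act"

lemma lookup_scal: "Poly_Mapping.lookup (scal a t) \<alpha> = scal0 a (Poly_Mapping.lookup t \<alpha>)"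
  by (simp add: tensor_scale_def map.rep_eq when_def flip: scal0_def)

lemma scal_single [simp]:
  "scal a (Poly_Mapping.single \<alpha> m) = Poly_Mapping.single \<alpha> (scal0 a m)"
  by (rule poly_mapping_eqI) (simp add: lookup_scal lookup_single when_def)

lemma scal_additive: "additive (scal a)"
  unfolding additive_def by (intro allI poly_mapping_eqI) (simp add: lookup_scal lookup_add)

lemma pt_eq_pm_extend: "pt f m = pm_extend (\<lambda>\<alpha> z. Poly_Mapping.single \<alpha> (scal0 z m)) f"
  by (simp add: pure_tensor_def pm_extend_def scal0_def)

lemma pt_additive_left: "additive (\<lambda>f. pt f m)"
  unfolding pt_eq_pm_extend
  by (intro additive_pm_extend) (simp add: additive_def scal0_add_left single_add)

lemmas pt_add_left = additive.add[OF pt_additive_left]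
  and pt_minus_left = additive.minus[OF pt_additive_left]
  and pt_0_left [simp] = additive.zero[OF pt_additive_left]

lemma pt_single [simp]: "pt (Poly_Mapping.single \<alpha> a) m = Poly_Mapping.single \<alpha> (scal0 a m)"
  unfolding pt_eq_pm_extend by (rule pm_extend_single) simp

lemma pt_additive: "additive (pt f)"
  unfolding additive_def
proof (intro allI)
  show "pt f (m + m') = pt f m + pt f m'" for m m'
    by (induction f rule: poly_mapping_single_add_induct) (simp_all add: single_add pt_add_left)
qed

lemmas pt_add = additive.add[OF pt_additive]
  and pt_minus = additive.minus[OF pt_additive]
  and pt_0 [simp] = additive.zero[OF pt_additive]

lemma pt_const_mult: "pt (const a * f) m = pt f (scal0 a m)"
  by (induction f rule: poly_mapping_single_add_induct)
    (simp_all add: const_def mult_single distrib_left pt_add_left flip: scal0_mult,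
     simp add: mult.commute)

lemma pt_const: "pt (const a) m = Poly_Mapping.single 0 (scal0 a m)"
  by (simp add: const_def)

lemma single_eq_const_mult: "Poly_Mapping.single \<alpha> a = const a * Poly_Mapping.single \<alpha> 1"
  by (simp add: const_def mult_single)

definition mul_x :: "'n \<Rightarrow> ('n, 'm) poly_tensor \<Rightarrow> ('n, 'm) poly_tensor" where
  "mul_x i = pm_extend (\<lambda>\<alpha>. Poly_Mapping.single (Poly_Mapping.single i 1 + \<alpha>))"

text \<open>Moving c_i to the right past x^\<alpha> costs one sign for each factor x_i.\<close>

definition cl :: "'n \<Rightarrow> ('n, 'm) poly_tensor \<Rightarrow> ('n, 'm) poly_tensor" where
  "cl i = pm_extend (\<lambda>\<alpha> m. Poly_Mapping.single \<alpha>
     (if even (Poly_Mapping.lookup \<alpha> i) then cl0 i m else - cl0 i m))"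

definition wg :: "'n weyl_D \<Rightarrow> ('n, 'm) poly_tensor \<Rightarrow> ('n, 'm) poly_tensor" where
  "wg w = pm_extend (\<lambda>\<alpha> m. pt (poly_act w (Poly_Mapping.single \<alpha> 1)) (wg0 w m))"

definition dunkl :: "'n \<Rightarrow> 'n poly_ring \<Rightarrow> 'm \<Rightarrow> ('n, 'm) poly_tensor" where
  "dunkl i f m =
     scal (- u) (\<Sum>k\<in>UNIV - {i}.
         pt (ddiff i k f) (wg0 (s_refl k i) m)
       + pt (ddiff_bar i k f) (cl0 k (cl0 i (wg0 (s_refl k i) m))))
   + scal (- u) (\<Sum>k\<in>UNIV - {i}.
         pt (ddiff_bar i k f) (wg0 (sbar_refl k i) m)
       - pt (ddiff i k f) (cl0 k (cl0 i (wg0 (sbar_refl k i) m))))"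

text \<open>Fixing the values on monomials gives an operator on the whole tensor product with no
  question of well-definedness; \<open>dunkl_op_pt\<close> recovers \<open>dunkl\<close> on every
  pure tensor.\<close>

definition dunkl_op :: "'n \<Rightarrow> ('n, 'm) poly_tensor \<Rightarrow> ('n, 'm) poly_tensor" where
  "dunkl_op i = pm_extend (\<lambda>\<alpha>. dunkl i (Poly_Mapping.single \<alpha> 1))"

lemma mul_x_additive: "additive (mul_x i)"
  unfolding mul_x_def by (intro additive_pm_extend additive_single)

lemma cl_additive: "additive (cl i)"
  unfolding cl_def by (intro additive_pm_extend) (simp add: additive_def flip: single_add)

lemma wg_additive: "additive (wg w)"
  unfolding wg_def by (intro additive_pm_extend) (simp add: additive_def pt_add)

lemma dunkl_additive: "additive (dunkl i f)"
  unfolding additive_def dunkl_def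
  by (simp add: pt_add sum.distrib sum_subtractf additive.add[OF scal_additive]
      additive.diff[OF scal_additive])

lemma dunkl_op_additive: "additive (dunkl_op i)"
  unfolding dunkl_op_def by (intro additive_pm_extend dunkl_additive)

lemmas linearP [simp] =
  scal_additive[THEN additive.add] scal_additive[THEN additive.minus]
  scal_additive[THEN additive.diff] scal_additive[THEN additive.zero]
  mul_x_additive[THEN additive.add] mul_x_additive[THEN additive.minus]
  mul_x_additive[THEN additive.diff] mul_x_additive[THEN additive.zero]
  cl_additive[THEN additive.add] cl_additive[THEN additive.minus]
  cl_additive[THEN additive.diff] cl_additive[THEN additive.zero]
  wg_additive[THEN additive.add] wg_additive[THEN additive.minus]
  wg_additive[THEN additive.diff] wg_additive[THEN additive.zero]
  dunkl_op_additive[THEN additive.add] dunkl_op_additive[THEN additive.minus]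
  dunkl_op_additive[THEN additive.diff] dunkl_op_additive[THEN additive.zero]

lemma dunkl_add_left: "dunkl i (f + g) m = dunkl i f m + dunkl i g m"
proof -
  \<comment> \<open>The divided differences obey their rules only for k different from i, so the
    congruence has to carry this condition into the sums.\<close>
  have *: "(\<Sum>k\<in>UNIV - {i}. h k) = (\<Sum>k\<in>UNIV - {i}. h' k)"
    if "\<And>k. k \<noteq> i \<Longrightarrow> h k = h' k" for h h' :: "'n \<Rightarrow> ('n, 'm) poly_tensor"
    using that by (intro sum.cong) auto
  have "dunkl i (f + g) m =
      scal (- u) (\<Sum>k\<in>UNIV - {i}.
         (pt (ddiff i k f) (wg0 (s_refl k i) m)
         + pt (ddiff_bar i k f) (cl0 k (cl0 i (wg0 (s_refl k i) m))))
       + (pt (ddiff i k g) (wg0 (s_refl k i) m)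
         + pt (ddiff_bar i k g) (cl0 k (cl0 i (wg0 (s_refl k i) m)))))
    + scal (- u) (\<Sum>k\<in>UNIV - {i}.
         (pt (ddiff_bar i k f) (wg0 (sbar_refl k i) m)
         - pt (ddiff i k f) (cl0 k (cl0 i (wg0 (sbar_refl k i) m))))
       + (pt (ddiff_bar i k g) (wg0 (sbar_refl k i) m)
         - pt (ddiff i k g) (cl0 k (cl0 i (wg0 (sbar_refl k i) m)))))"
    unfolding dunkl_def
    by (rule arg_cong2[of _ _ _ _ "(+)"]; rule arg_cong[of _ _ "scal (- u)"]; rule *)
      (simp_all add: ddiff_add ddiff_bar_add pt_add_left algebra_simps)
  also have "\<dots> = dunkl i f m + dunkl i g m"
    unfolding dunkl_def sum.distrib by simp
  finally show ?thesis .
qed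

text \<open>Moves coefficients from the polynomial to the module element, since
  \<open>dunkl_op\<close> applies \<open>dunkl\<close> only to monomials with coefficient 1.\<close>

lemma dunkl_const_mult: "dunkl i (const a * f) m = dunkl i f (scal0 a m)"
  unfolding dunkl_def
  by (intro arg_cong2[of _ _ _ _ "(+)"] arg_cong[of _ _ "scal (- u)"] sum.cong refl)
    (auto simp: ddiff_const_mult ddiff_bar_const_mult pt_const_mult cl0_scal0 wg0_scal0)

lemma mul_x_single [simp]: "mul_x i (Poly_Mapping.single \<alpha> m) =
    Poly_Mapping.single (Poly_Mapping.single i 1 + \<alpha>) m"
  unfolding mul_x_def by (rule pm_extend_single) simp

lemma cl_single [simp]: "cl i (Poly_Mapping.single \<alpha> m) = Poly_Mapping.single \<alpha>
    (if even (Poly_Mapping.lookup \<alpha> i) then cl0 i m else - cl0 i m)"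
  unfolding cl_def by (rule pm_extend_single) simp

lemma wg_single: "wg w (Poly_Mapping.single \<alpha> m) =
    pt (poly_act w (Poly_Mapping.single \<alpha> 1)) (wg0 w m)"
  unfolding wg_def by (rule pm_extend_single) simp

lemma dunkl_op_single: "dunkl_op i (Poly_Mapping.single \<alpha> m) =
    dunkl i (Poly_Mapping.single \<alpha> 1) m"
  unfolding dunkl_op_def by (rule pm_extend_single) (rule additive.zero[OF dunkl_additive])

lemma mul_x_pt: "mul_x i (pt f m) = pt (px i * f) m"
  by (induction f rule: poly_mapping_single_add_induct)
    (simp_all add: px_mult_single distrib_left pt_add_left)

lemma wg_pt: "wg w (pt f m) = pt (poly_act w f) (wg0 w m)"
proof (induction f rule: poly_mapping_single_add_induct)
  case (single \<alpha> a)
  show ?case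
    by (subst (2) single_eq_const_mult)
      (simp add: wg_single wg0_scal0 poly_act_const_mult pt_const_mult)
qed (simp add: poly_act_add pt_add_left)

lemma dunkl_op_pt: "dunkl_op i (pt f m) = dunkl i f m"
proof (induction f rule: poly_mapping_single_add_induct)
  case (single \<alpha> a)
  show ?case
    by (subst (2) single_eq_const_mult) (simp add: dunkl_op_single dunkl_const_mult)
qed (simp add: pt_add_left dunkl_add_left)

lemma poly_tensor_induct [case_names pt add]:
  assumes "\<And>f m. Q (pt f m)" and "\<And>s t. Q s \<Longrightarrow> Q t \<Longrightarrow> Q (s + t)"
  shows "Q t"
  using assms(1)[of "Poly_Mapping.single _ 1"] assms(2)
  by (induction t rule: poly_mapping_single_add_induct) simp_all

text \<open>Every single term arises from a constant by multiplications with the x_i; this provides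
  the induction axiom of \<open>dunkl_rep\<close>.\<close>

lemma poly_tensor_mul_x_induct:
  assumes "\<And>m. Q (Poly_Mapping.single 0 m)" and "\<And>i t. Q t \<Longrightarrow> Q (mul_x i t)"
    and "\<And>s t. Q s \<Longrightarrow> Q t \<Longrightarrow> Q (s + t)"
  shows "Q t"
proof (induction t rule: poly_mapping_single_add_induct)
  case (single \<alpha> m)
  show ?case
    by (induction \<alpha> rule: monomial_induct) (use assms(1,2) mul_x_single in \<open>metis+\<close>)
qed (rule assms(3))

lemma wg_mul_x: "wg w (mul_x i t) = signed (wsign w i) (mul_x (wperm w i) (wg w t))"
proof (induction t rule: poly_tensor_induct)
  case (pt f m)
  show ?case
    using wsign_cases[of w i]
    by (auto simp: mul_x_pt wg_pt poly_act_px_mult pt_minus_left)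
qed (simp add: signed_def)

lemma cl_mul_x: "cl i (mul_x j t) = (if i = j then - mul_x j (cl i t) else mul_x j (cl i t))"
  by (induction t rule: poly_mapping_single_add_induct)
    (auto simp: lookup_add lookup_single single_uminus)

text \<open>Passing c_k c_i through a polynomial changes the signs of x_k and x_i, which exchanges
  f^s and f^sbar. Hence in the Dunkl formula c_k c_i accompanies the divided difference of the other
  reflection.\<close>

lemma cl_cl_wg_pt:
  assumes "k \<noteq> i"
  shows "cl k (cl i (wg (s_refl k i) (pt f m)))
      = pt (poly_act (sbar_refl k i) f) (cl0 k (cl0 i (wg0 (s_refl k i) m)))"
    and "cl k (cl i (wg (sbar_refl k i) (pt f m)))
      = pt (poly_act (s_refl k i) f) (cl0 k (cl0 i (wg0 (sbar_refl k i) m)))"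
proof (induction f rule: poly_induct)
  case (const a)
  show "cl k (cl i (wg (s_refl k i) (pt (const a) m)))
      = pt (poly_act (sbar_refl k i) (const a)) (cl0 k (cl0 i (wg0 (s_refl k i) m)))"
    and "cl k (cl i (wg (sbar_refl k i) (pt (const a) m)))
      = pt (poly_act (s_refl k i) (const a)) (cl0 k (cl0 i (wg0 (sbar_refl k i) m)))"
    unfolding wg_pt poly_act_const by (simp_all add: pt_const wg0_scal0 cl0_scal0)
next
  case (px j f)
  have p: "transpose k i j = (if j = k then i else if j = i then k else j)"
    by (simp add: transpose_def)
  show "cl k (cl i (wg (s_refl k i) (pt (px j * f) m)))
      = pt (poly_act (sbar_refl k i) (px j * f)) (cl0 k (cl0 i (wg0 (s_refl k i) m)))"
    and "cl k (cl i (wg (sbar_refl k i) (pt (px j * f) m)))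
      = pt (poly_act (s_refl k i) (px j * f)) (cl0 k (cl0 i (wg0 (sbar_refl k i) m)))"
    using assms px
    by (auto simp: poly_act_px_mult wg_mul_x cl_mul_x p pt_minus_left simp flip: mul_x_pt)
qed (simp_all add: pt_add_left poly_act_add)

sublocale commutator_ops u scal cl wg .

lemma A_pt: "k \<noteq> i \<Longrightarrow> A k i (pt f m) = pt (poly_act (s_refl k i) f) (wg0 (s_refl k i) m)
    + pt (poly_act (sbar_refl k i) f) (cl0 k (cl0 i (wg0 (s_refl k i) m)))"
  by (simp add: A_def cl_cl_wg_pt) (simp add: wg_pt)

lemma B_pt: "k \<noteq> i \<Longrightarrow> B k i (pt f m) = pt (poly_act (sbar_refl k i) f) (wg0 (sbar_refl k i) m)
    - pt (poly_act (s_refl k i) f) (cl0 k (cl0 i (wg0 (sbar_refl k i) m)))"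
  by (simp add: B_def cl_cl_wg_pt) (simp add: wg_pt)

lemma dunkl_px_mult: "dunkl i (px j * f) m = mul_x j (dunkl i f m) + D i j (pt f m)"
proof -
  \<comment> \<open>Both sums of \<open>dunkl\<close> carry the factor -u; \<open>T k f\<close> is
    the joint contribution of the index k.\<close>
  define T where "T k f =
      pt (ddiff i k f) (wg0 (s_refl k i) m)
    + pt (ddiff_bar i k f) (cl0 k (cl0 i (wg0 (s_refl k i) m)))
    + (pt (ddiff_bar i k f) (wg0 (sbar_refl k i) m)
    - pt (ddiff i k f) (cl0 k (cl0 i (wg0 (sbar_refl k i) m))))" for k f
  have dunkl: "dunkl i f m = scal (- u) (\<Sum>k\<in>UNIV - {i}. T k f)" for f
    by (simp only: dunkl_def T_def sum.distrib linearP)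
  let ?R = "if j = i then \<Sum>k\<in>UNIV - {i}. A k i (pt f m) + B k i (pt f m)
      else - (A i j (pt f m) - B i j (pt f m))"
  \<comment> \<open>For j = i every k contributes a correction. Otherwise only k = j does, and c_k
    c_i = - c_i c_k turns its terms into those of \<open>A i j\<close> and
    \<open>B i j\<close>.\<close>
  have T: "T k (px j * f) = mul_x j (T k f) + (if j = i then A k i (pt f m) + B k i (pt f m)
      else if k = j then - (A i j (pt f m) - B i j (pt f m)) else 0)" if "k \<noteq> i" for k
    using that cl0_anti[of i k]
    by (auto simp: T_def ddiff_px_mult ddiff_bar_px_mult pt_add_left pt_minus_left pt_minus
        A_pt B_pt s_refl_commute[of i j] sbar_refl_commute[of i j] simp flip: mul_x_pt)
  have "(\<Sum>k\<in>UNIV - {i}. T k (px j * f)) = (\<Sum>k\<in>UNIV - {i}. mul_x j (T k f) +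
      (if j = i then A k i (pt f m) + B k i (pt f m)
      else if k = j then - (A i j (pt f m) - B i j (pt f m)) else 0))"
    by (intro sum.cong) (auto simp: T)
  also have "\<dots> = mul_x j (\<Sum>k\<in>UNIV - {i}. T k f) + ?R"
    unfolding additive.sum[OF mul_x_additive] sum.distrib by (auto simp: sum.distrib)
  finally have "dunkl i (px j * f) m = scal (- u) (mul_x j (\<Sum>k\<in>UNIV - {i}. T k f)) + scal (- u) ?R"
    by (simp only: dunkl linearP)
  moreover have "scal a (mul_x j t) = mul_x j (scal a t)" for a t
    by (induction t rule: poly_mapping_single_add_induct) simp_all
  moreover have "scal (- u) t = - scal u t" for t
    by (rule poly_mapping_eqI)
      (simp add: lookup_scal additive.minus[OF scal0_additive_left])
  ultimately show ?thesis
    by (simp add: dunkl D_def)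
qed

text \<open>From here on \<open>ev\<close> is a concrete action of the free algebra in which all
  defining relations act by zero, including the commutativity of the Dunkl operators.\<close>

sublocale dunkl_rep u scal cl wg scal0 cl0 wg0 "Poly_Mapping.single 0" mul_x dunkl_op
proof
  show "dunkl_op i (mul_x j t) = mul_x j (dunkl_op i t) + D i j t" for i j t
  proof (induction t rule: poly_tensor_induct)
    case (pt f m)
    show ?case by (simp only: mul_x_pt dunkl_op_pt dunkl_px_mult)
  qed (simp add: D_def A_def B_def sum.distrib sum_subtractf algebra_simps)
  show "dunkl_op i (Poly_Mapping.single 0 m) = 0" for i m
    unfolding dunkl_op_single
    using ddiff_const[of i _ 1] ddiff_bar_const[of i _ 1]
    by (simp add: dunkl_def const_def)
  show "wg w (Poly_Mapping.single 0 m) = Poly_Mapping.single 0 (wg0 w m)" for w m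
    using wg_pt[of w "const 1" m] by (simp add: pt_const)
  show "mul_x i (mul_x j t) = mul_x j (mul_x i t)" for i j t
    by (induction t rule: poly_mapping_single_add_induct) (simp_all add: add.left_commute)
  show "scal a (mul_x i t) = mul_x i (scal a t)" for a i t
    by (induction t rule: poly_mapping_single_add_induct) simp_all
qed (simp_all add: single_add cl0_sq wg0_one wg0_mult wg0_cl0 scal0_add_left scal0_mult cl0_scal0
    wg0_scal0 wg_mul_x cl_mul_x, (erule cl0_anti | rule poly_tensor_mul_x_induct; assumption)+)

end

section \<open>The induced module\<close>

lemma poly_mapping_sum_single:
  "(\<Sum>\<alpha>\<in>Poly_Mapping.keys t. Poly_Mapping.single \<alpha> (Poly_Mapping.lookup t \<alpha>)) = t"
  by (rule poly_mapping_eqI) (auto simp: lookup_sum lookup_single when_def in_keys_iff)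

lemma additive_group_comm_group:
  "comm_group \<lparr>carrier = UNIV, monoid.mult = (+), one = (0 :: 'p::ab_group_add)\<rparr>"
proof (rule comm_groupI)
  show "\<exists>y\<in>carrier \<lparr>carrier = UNIV, monoid.mult = (+), one = (0 :: 'p)\<rparr>.
      y \<otimes>\<^bsub>\<lparr>carrier = UNIV, monoid.mult = (+), one = (0 :: 'p)\<rparr>\<^esub> x
        = \<one>\<^bsub>\<lparr>carrier = UNIV, monoid.mult = (+), one = (0 :: 'p)\<rparr>\<^esub>" for x
    by (rule bexI[of _ "- x"]) simp_all
qed (simp_all add: add_ac)

section \<open>Tensor products over a subring\<close>

locale tensor_product =
  fixes R :: "('r, 'x) ring_scheme" (structure) and T :: "'r set"
    and \<rho> :: "'r \<Rightarrow> 'm::ab_group_add \<Rightarrow> 'm"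
  assumes ring_R: "ring R" and T_subset: "T \<subseteq> carrier R"
begin

sublocale ring R by (rule ring_R)

abbreviation F :: "('r \<times> 'm \<Rightarrow>\<^sub>0 int) monoid" where
  "F \<equiv> free_Abelian_group (carrier R \<times> UNIV)"

definition J :: "('r \<times> 'm \<Rightarrow>\<^sub>0 int) set" where
  "J = generate F (tensor_relations R T \<rho>)"

lemma tensor_relations_carrier: "tensor_relations R T \<rho> \<subseteq> carrier F"
proof -
  have d: "x - y \<in> carrier F" if "x \<in> carrier F" "y \<in> carrier F" for x y :: "'r \<times> 'm \<Rightarrow>\<^sub>0 int"
    using that keys_diff[of x y] by auto
  show ?thesis
    unfolding tensor_relations_def using T_subset
    by (auto simp del: carrier_free_Abelian_group_iff intro!: d)
qed

lemma J_carrier: "z \<in> J \<Longrightarrow> z \<in> carrier F"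
  unfolding J_def
  by (rule group.generate_in_carrier[OF group_free_Abelian_group tensor_relations_carrier])

lemma J_0: "0 \<in> J"
  unfolding J_def using generate.one[of F] by simp

lemma J_add: "z \<in> J \<Longrightarrow> z' \<in> J \<Longrightarrow> z + z' \<in> J"
  unfolding J_def using generate.eng[of z F _ z'] by simp

lemma J_minus: "z \<in> J \<Longrightarrow> - z \<in> J"
  using group.generate_m_inv_closed[OF group_free_Abelian_group tensor_relations_carrier, of z]
    J_carrier[of z] by (simp add: J_def)

lemma J_sum: "(\<And>i. i \<in> I \<Longrightarrow> z i \<in> J) \<Longrightarrow> sum z I \<in> J"
  by (induction I rule: infinite_finite_induct) (auto intro: J_0 J_add)

lemma J_rel: "r \<in> tensor_relations R T \<rho> \<Longrightarrow> r \<in> J"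
  unfolding J_def by (rule generate.incl)

lemma J_induct [consumes 1, case_names rel zero minus add]:
  assumes "z \<in> J"
    and "\<And>z. z \<in> tensor_relations R T \<rho> \<Longrightarrow> P z" "P 0"
    and "\<And>z. z \<in> carrier F \<Longrightarrow> P z \<Longrightarrow> P (- z)"
    and "\<And>z z'. z \<in> carrier F \<Longrightarrow> z' \<in> carrier F \<Longrightarrow> P z \<Longrightarrow> P z' \<Longrightarrow> P (z + z')"
  shows "P z"
  using assms(1) unfolding J_def
proof (induction rule: generate.induct)
  case (inv h)
  then have "h \<in> carrier F" using tensor_relations_carrier by blast
  then show ?case using assms(2,4) inv by simp
next
  case (eng g h)
  then show ?case using assms(5) J_carrier by (simp add: J_def del: carrier_free_Abelian_group_iff)
qed (simp_all add: assms(2,3))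

section \<open>Congruence modulo the tensor relations\<close>

definition eqv :: "('r \<times> 'm \<Rightarrow>\<^sub>0 int) \<Rightarrow> ('r \<times> 'm \<Rightarrow>\<^sub>0 int) \<Rightarrow> bool" (infix \<open>\<sim>\<^sub>J\<close> 50) where
  "z \<sim>\<^sub>J z' \<longleftrightarrow> z - z' \<in> J"

lemma eqv_refl [simp]: "z \<sim>\<^sub>J z"
  by (simp add: eqv_def J_0)

lemma eqv_sym: "z \<sim>\<^sub>J z' \<Longrightarrow> z' \<sim>\<^sub>J z"
  unfolding eqv_def using J_minus[of "z - z'"] by simp

lemma eqv_trans [trans]: "x \<sim>\<^sub>J y \<Longrightarrow> y \<sim>\<^sub>J z \<Longrightarrow> x \<sim>\<^sub>J z"
  unfolding eqv_def using J_add[of "x - y" "y - z"] by simp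

lemma eqv_add: "x \<sim>\<^sub>J x' \<Longrightarrow> y \<sim>\<^sub>J y' \<Longrightarrow> x + y \<sim>\<^sub>J x' + y'"
  unfolding eqv_def using J_add[of "x - x'" "y - y'"] by (simp add: algebra_simps)

lemma eqv_minus: "x \<sim>\<^sub>J x' \<Longrightarrow> - x \<sim>\<^sub>J - x'"
  unfolding eqv_def using J_minus[of "x - x'"] by simp

lemma tensor_coset_eq: "tensor_coset R T \<rho> z = {z'. z' \<sim>\<^sub>J z}"
proof -
  have "tensor_coset R T \<rho> z = (\<lambda>j. j + z) ` J"
    by (auto simp: tensor_coset_def r_coset_def J_def)
  also have "\<dots> = {z'. z' \<sim>\<^sub>J z}"
    by (auto simp: eqv_def intro: image_eqI[of _ _ "_ - z"])
  finally show ?thesis .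
qed

lemma tensor_coset_eq_iff: "tensor_coset R T \<rho> z = tensor_coset R T \<rho> z' \<longleftrightarrow> z \<sim>\<^sub>J z'"
  unfolding tensor_coset_eq by (auto intro: eqv_trans eqv_sym)

lemma frag_of_add_left: "a \<in> carrier R \<Longrightarrow> b \<in> carrier R \<Longrightarrow>
    frag_of (a \<oplus> b, m) \<sim>\<^sub>J frag_of (a, m) + frag_of (b, m)"
  unfolding eqv_def diff_diff_eq[symmetric]
  by (rule J_rel) (unfold tensor_relations_def, blast)

lemma frag_of_add_right: "a \<in> carrier R \<Longrightarrow>
    frag_of (a, m + m') \<sim>\<^sub>J frag_of (a, m) + frag_of (a, m')"
  unfolding eqv_def diff_diff_eq[symmetric]
  by (rule J_rel) (unfold tensor_relations_def, blast)

lemma frag_of_balanced: "a \<in> carrier R \<Longrightarrow> s \<in> T \<Longrightarrow> frag_of (a \<otimes> s, m) \<sim>\<^sub>J frag_of (a, \<rho> s m)"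
  unfolding eqv_def by (rule J_rel) (unfold tensor_relations_def, blast)

lemma frag_of_zero_right: "a \<in> carrier R \<Longrightarrow> frag_of (a, 0) \<sim>\<^sub>J 0"
  using frag_of_add_right[of a 0 0] J_minus[of "- frag_of (a, 0)"] by (simp add: eqv_def)

definition L :: "'r \<Rightarrow> ('r \<times> 'm \<Rightarrow>\<^sub>0 int) \<Rightarrow> ('r \<times> 'm \<Rightarrow>\<^sub>0 int)" where
  "L a = frag_extend (\<lambda>(b, m). frag_of (a \<otimes> b, m))"

lemma L_frag_of [simp]: "L a (frag_of (b, m)) = frag_of (a \<otimes> b, m)"
  by (simp add: L_def)

lemma L_linear: "L a (z + z') = L a z + L a z'" "L a (- z) = - L a z" "L a (z - z') = L a z - L a z'"
  "L a 0 = 0"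
  by (simp_all add: L_def frag_extend_add frag_extend_minus frag_extend_diff)

text \<open>Left multiplication touches only the left factor: distributivity preserves the
  additivity relations and associativity the balancing ones.\<close>

lemma L_rel:
  assumes a: "a \<in> carrier R" and "z \<in> tensor_relations R T \<rho>"
  shows "L a z \<in> tensor_relations R T \<rho>"
  using assms(2) unfolding tensor_relations_def
proof (elim UnE CollectE exE conjE, goal_cases)
  case (1 b c m)
  then show ?case using a by (intro UnI1 CollectI exI[of _ "a \<otimes> b"] exI[of _ "a \<otimes> c"])
      (auto simp: L_linear r_distr)
next
  case (2 b m m')
  then show ?case using a by (intro UnI1 UnI2 CollectI exI[of _ "a \<otimes> b"]) (auto simp: L_linear)
next
  case (3 b s m)
  then have "a \<otimes> (b \<otimes> s) = a \<otimes> b \<otimes> s" using a T_subset by (auto simp: m_assoc)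
  with 3 have "L a z = frag_of (a \<otimes> b \<otimes> s, m) - frag_of (a \<otimes> b, \<rho> s m)"
    by (simp add: L_linear)
  moreover have "a \<otimes> b \<in> carrier R" using a 3 by simp
  ultimately show ?case using 3 by blast
qed

lemma L_J:
  assumes "a \<in> carrier R" and "z \<in> J"
  shows "L a z \<in> J"
  using assms(2)
  by (induction z rule: J_induct)
    (use assms(1) in \<open>auto simp: L_linear intro: J_rel L_rel J_0 J_minus J_add\<close>)

lemma L_eqv: "a \<in> carrier R \<Longrightarrow> z \<sim>\<^sub>J z' \<Longrightarrow> L a z \<sim>\<^sub>J L a z'"
  unfolding eqv_def using L_J by (simp flip: L_linear)

text \<open>An exact equality in the free group, in contrast to \<open>L_add\<close>, but restricted
  to formal sums with entries from R, where associativity is available.\<close>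

lemma L_mult:
  assumes a: "a \<in> carrier R" "b \<in> carrier R" and "z \<in> carrier F"
  shows "L (a \<otimes> b) z = L a (L b z)"
proof (rule free_Abelian_group_induct[where P = "\<lambda>z. L (a \<otimes> b) z = L a (L b z)"])
  show "Poly_Mapping.keys z \<subseteq> carrier R \<times> UNIV" using assms(3) by simp
qed (use a in \<open>auto simp: L_linear m_assoc\<close>)

lemma L_add:
  assumes a: "a \<in> carrier R" "b \<in> carrier R" and "z \<in> carrier F"
  shows "L (a \<oplus> b) z \<sim>\<^sub>J L a z + L b z"
proof (rule free_Abelian_group_induct[where P = "\<lambda>z. L (a \<oplus> b) z \<sim>\<^sub>J L a z + L b z"])
  show "Poly_Mapping.keys z \<subseteq> carrier R \<times> UNIV" using assms(3) by simp
next
  fix x y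
  assume "L (a \<oplus> b) x \<sim>\<^sub>J L a x + L b x" "L (a \<oplus> b) y \<sim>\<^sub>J L a y + L b y"
  then have "L (a \<oplus> b) x + - L (a \<oplus> b) y \<sim>\<^sub>J (L a x + L b x) + - (L a y + L b y)"
    by (intro eqv_add eqv_minus)
  then show "L (a \<oplus> b) (x - y) \<sim>\<^sub>J L a (x - y) + L b (x - y)"
    by (simp add: L_linear algebra_simps)
next
  fix p :: "'r \<times> 'm"
  assume "p \<in> carrier R \<times> UNIV"
  then show "L (a \<oplus> b) (frag_of p) \<sim>\<^sub>J L a (frag_of p) + L b (frag_of p)"
    using a by (cases p) (auto simp: l_distr intro: frag_of_add_left)
qed (simp add: L_linear)

text \<open>The union in the definition runs over all representatives. Each contributes the same
  coset because \<open>L a\<close> respects the congruence, and there is at least one.\<close>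

lemma induced_act_coset:
  assumes "a \<in> carrier R"
  shows "induced_act R T \<rho> a (tensor_coset R T \<rho> z) = tensor_coset R T \<rho> (L a z)"
proof -
  have *: "tensor_coset R T \<rho> (L a z') = tensor_coset R T \<rho> (L a z)" if "z' \<sim>\<^sub>J z" for z'
    using L_eqv[OF assms that] by (simp add: tensor_coset_eq_iff)
  have "(\<Union>z'\<in>{z'. z' \<sim>\<^sub>J z}. tensor_coset R T \<rho> (L a z'))
      = (\<Union>z'\<in>{z'. z' \<sim>\<^sub>J z}. tensor_coset R T \<rho> (L a z))"
    by (intro SUP_cong refl *) simp
  moreover have "{z'. z' \<sim>\<^sub>J z} \<noteq> {}" using eqv_refl[of z] by blast
  ultimately show ?thesis
    unfolding induced_act_def L_def[symmetric] tensor_coset_eq[of z]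
    by (simp only: UN_constant if_False)
qed

text \<open>The free abelian group supplies a homomorphism, and the three hypotheses say that it
  kills the three families of tensor relations. It is controlled only on the carrier of
  \<open>F\<close>, hence the side conditions.\<close>

lemma tensor_lift:
  fixes \<phi> :: "'r \<Rightarrow> 'm \<Rightarrow> 'p::ab_group_add"
  assumes left: "\<And>a b m. a \<in> carrier R \<Longrightarrow> b \<in> carrier R \<Longrightarrow> \<phi> (a \<oplus> b) m = \<phi> a m + \<phi> b m"
    and right: "\<And>a m m'. a \<in> carrier R \<Longrightarrow> \<phi> a (m + m') = \<phi> a m + \<phi> a m'"
    and balanced: "\<And>a s m. a \<in> carrier R \<Longrightarrow> s \<in> T \<Longrightarrow> \<phi> (a \<otimes> s) m = \<phi> a (\<rho> s m)"
  obtains \<Phi> where "\<And>z z'. z \<in> carrier F \<Longrightarrow> z' \<in> carrier F \<Longrightarrow> \<Phi> (z + z') = \<Phi> z + \<Phi> z'"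
    and "\<And>a m. a \<in> carrier R \<Longrightarrow> \<Phi> (frag_of (a, m)) = \<phi> a m"
    and "\<And>z z'. z \<in> carrier F \<Longrightarrow> z' \<in> carrier F \<Longrightarrow> z \<sim>\<^sub>J z' \<Longrightarrow> \<Phi> z = \<Phi> z'"
proof -
  let ?G = "\<lparr>carrier = UNIV, monoid.mult = (+), one = (0 :: 'p)\<rparr>"
  obtain \<Phi> where hom: "\<Phi> \<in> hom F ?G"
    and frag: "\<And>x. x \<in> carrier R \<times> UNIV \<Longrightarrow> \<Phi> (frag_of x) = (\<lambda>(a, m). \<phi> a m) x"
    by (rule comm_group.free_Abelian_group_universal[OF additive_group_comm_group,
          of "\<lambda>(a, m). \<phi> a m" "carrier R \<times> UNIV"]) auto
  have add: "\<Phi> (z + z') = \<Phi> z + \<Phi> z'" if "z \<in> carrier F" "z' \<in> carrier F" for z z'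
    using hom_mult[OF hom that] by simp
  have zero: "\<Phi> 0 = 0" using add[of 0 0] by simp
  have minus: "\<Phi> (- z) = - \<Phi> z" if "z \<in> carrier F" for z
    using add[of z "- z"] that zero by (simp add: eq_neg_iff_add_eq_0 add.commute)
  have diff: "\<Phi> (z - z') = \<Phi> z - \<Phi> z'" if "z \<in> carrier F" "z' \<in> carrier F" for z z'
    using add[of z "- z'"] minus[of z'] that by simp
  have diff_carrier: "z - z' \<in> carrier F" if "z \<in> carrier F" "z' \<in> carrier F"
    for z z' :: "'r \<times> 'm \<Rightarrow>\<^sub>0 int"
    using that keys_diff[of z z'] by auto
  have J: "\<Phi> z = 0" if "z \<in> J" for z
    using that
  proof (induction z rule: J_induct)
    case (rel z)
    note [simp del] = carrier_free_Abelian_group_iff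
    from rel show ?case
      unfolding tensor_relations_def using T_subset
      by (auto simp: diff diff_carrier frag left right balanced subset_iff)
  qed (simp_all only: zero minus add, simp_all)
  show thesis
  proof
    show "\<Phi> z = \<Phi> z'" if "z \<in> carrier F" "z' \<in> carrier F" "z \<sim>\<^sub>J z'" for z z'
      using J[of "z - z'"] diff[OF that(1,2)] that(3) by (simp add: eqv_def)
  qed (use add frag in auto)
qed

end

section \<open>The polynomial module over the algebra, and the zero extension\<close>

context K_module
begin

abbreviation hc :: "'n H_gen free_alg \<Rightarrow> 'n H_gen free_alg set" where
  "hc \<equiv> cls (H_rels u)"

text \<open>A class acts through a chosen representative; \<open>hact_cls\<close> shows that the
  choice does not matter.\<close>

definition hact :: "'n H_gen free_alg set \<Rightarrow> ('n, 'm) poly_tensor \<Rightarrow> ('n, 'm) poly_tensor" where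
  "hact h = ev (SOME a. hc a = h)"

lemma hact_cls [simp]: "hact (hc a) t = ev a t"
proof -
  have "hc (SOME b. hc b = hc a) = hc a" by (rule someI) (rule refl)
  then show ?thesis unfolding hact_def using ev_cong[of "H_rels u"] ev_H_rels by blast
qed

lemma H_alg_simps:
  "carrier (H_alg u) = range hc" "hc a \<oplus>\<^bsub>H_alg u\<^esub> hc b = hc (a + b)"
  "hc a \<otimes>\<^bsub>H_alg u\<^esub> hc b = hc (a * b)" "\<one>\<^bsub>H_alg u\<^esub> = hc 1" "\<ominus>\<^bsub>H_alg u\<^esub> hc a = hc (- a)"
  by (simp_all add: H_alg_def carrier_presented cls_add cls_mult cls_one cls_minus)

lemma ring_H_alg: "ring (H_alg u)"
  by (simp add: H_alg_def ring_presented)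

abbreviation Hy :: "'n H_gen free_alg set ring" where
  "Hy \<equiv> Hy_alg u"

definition Hy_gens :: "'n H_gen free_alg set set" where
  "Hy_gens = hc ` (range const \<union> range (\<lambda>i. gen (HC i)) \<union> range (\<lambda>w. gen (HW w))
     \<union> range (\<lambda>i. gen (HY i)))"

lemma Hy_eq: "Hy = (H_alg u)\<lparr>carrier := generate_ring (H_alg u) Hy_gens\<rparr>"
  by (simp add: Hy_alg_def Hy_gens_def)

lemma carrier_Hy: "carrier Hy = generate_ring (H_alg u) Hy_gens"
  by (simp add: Hy_eq)

lemma Hy_ops: "(\<otimes>\<^bsub>Hy\<^esub>) = (\<otimes>\<^bsub>H_alg u\<^esub>)" "(\<oplus>\<^bsub>Hy\<^esub>) = (\<oplus>\<^bsub>H_alg u\<^esub>)" "\<one>\<^bsub>Hy\<^esub> = \<one>\<^bsub>H_alg u\<^esub>"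
  "\<zero>\<^bsub>Hy\<^esub> = \<zero>\<^bsub>H_alg u\<^esub>"
  by (simp_all add: Hy_eq)

lemma Hy_gens_carrier: "Hy_gens \<subseteq> carrier (H_alg u)"
  by (auto simp: Hy_gens_def H_alg_simps)

lemma ring_Hy: "ring Hy"
  unfolding Hy_eq by (rule ring.generate_ring_is_ring[OF ring_H_alg Hy_gens_carrier])

lemma carrier_Hy_subset: "carrier Hy \<subseteq> carrier (H_alg u)"
  unfolding carrier_Hy by (rule ring.generate_ring_incl[OF ring_H_alg Hy_gens_carrier])

lemma Hy_cls: "h \<in> carrier Hy \<Longrightarrow> \<exists>a. h = hc a"
  using carrier_Hy_subset by (auto simp: H_alg_simps)

lemma Hy_gen_in:
  "hc (const a) \<in> carrier Hy" "hc (gen (HC i)) \<in> carrier Hy" "hc (gen (HW w)) \<in> carrier Hy"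
  "hc (gen (HY i)) \<in> carrier Hy"
  unfolding carrier_Hy by (rule generate_ring.incl; auto simp: Hy_gens_def)+

text \<open>\<open>\<H>\<^sub>y\<close> preserves the constant polynomials, which therefore carry a zero extension of \<open>act\<close>.\<close>

definition rho :: "'n H_gen free_alg set \<Rightarrow> 'm \<Rightarrow> 'm" where
  "rho h m = Poly_Mapping.lookup (hact h (Poly_Mapping.single 0 m)) 0"

text \<open>K acts inside degree 0 and the y_i kill it, and this property passes through all ring
  operations. It makes \<open>rho\<close> multiplicative, since reading off one coefficient then
  loses nothing.\<close>

lemma Hy_preserves_constants:
  assumes "h \<in> carrier Hy"
  shows "\<exists>a. h = hc a \<and> (\<forall>m. ev a (Poly_Mapping.single 0 m) = Poly_Mapping.single 0 (rho h m))"
proof -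
  \<comment> \<open>The resulting constant is left unspecified during the induction; afterwards the
    coefficient at 0 identifies it as \<open>rho h m\<close>.\<close>
  have *: "\<exists>a. h = hc a \<and> (\<forall>m. \<exists>m'. ev a (Poly_Mapping.single 0 m) = Poly_Mapping.single 0 m')"
    using assms unfolding carrier_Hy
  proof (induction rule: generate_ring.induct)
    case one
    show ?case by (intro exI[of _ 1]) (auto simp: H_alg_simps ev_one)
  next
    case (incl h)
    have "\<exists>m'. ev a (Poly_Mapping.single 0 m) = Poly_Mapping.single 0 m'"
      if "a \<in> range const \<union> range (\<lambda>i. gen (HC i)) \<union> range (\<lambda>w. gen (HW w)) \<union> range (\<lambda>i. gen (HY i))"
      for a m
      using that Y_inc[of _ m] by (auto simp: ev_const ev_gen intro: exI[of _ 0])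
    with incl show ?case unfolding Hy_gens_def by blast
  next
    case (a_inv h)
    then obtain a where a: "h = hc a"
      "\<And>m. \<exists>m'. ev a (Poly_Mapping.single 0 m) = Poly_Mapping.single 0 m'" by blast
    have "\<exists>m'. ev (- a) (Poly_Mapping.single 0 m) = Poly_Mapping.single 0 m'" for m
      using a(2)[of m] by (metis ev_minus single_uminus)
    then show ?case using a(1) by (auto simp: H_alg_simps intro!: exI[of _ "- a"])
  next
    case (eng_add h h')
    then obtain a b where a: "h = hc a"
      "\<And>m. \<exists>m'. ev a (Poly_Mapping.single 0 m) = Poly_Mapping.single 0 m'" and b: "h' = hc b"
      "\<And>m. \<exists>m'. ev b (Poly_Mapping.single 0 m) = Poly_Mapping.single 0 m'" by blast
    have "\<exists>m'. ev (a + b) (Poly_Mapping.single 0 m) = Poly_Mapping.single 0 m'" for m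
      using a(2)[of m] b(2)[of m] by (metis ev_add single_add)
    then show ?case using a(1) b(1) by (auto simp: H_alg_simps intro!: exI[of _ "a + b"])
  next
    case (eng_mult h h')
    then obtain a b where a: "h = hc a"
      "\<And>m. \<exists>m'. ev a (Poly_Mapping.single 0 m) = Poly_Mapping.single 0 m'" and b: "h' = hc b"
      "\<And>m. \<exists>m'. ev b (Poly_Mapping.single 0 m) = Poly_Mapping.single 0 m'" by blast
    have "\<exists>m'. ev (a * b) (Poly_Mapping.single 0 m) = Poly_Mapping.single 0 m'" for m
    proof -
      obtain m' where "ev b (Poly_Mapping.single 0 m) = Poly_Mapping.single 0 m'" using b(2) by blast
      then show ?thesis using a(2)[of m'] by (simp add: ev_mult)
    qed
    then show ?case using a(1) b(1) by (auto simp: H_alg_simps intro!: exI[of _ "a * b"])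
  qed
  then obtain a where a: "h = hc a"
    "\<And>m. \<exists>m'. ev a (Poly_Mapping.single 0 m) = Poly_Mapping.single 0 m'" by blast
  have "ev a (Poly_Mapping.single 0 m) = Poly_Mapping.single 0 (rho h m)" for m
    using a(2)[of m] by (auto simp: rho_def a(1))
  with a(1) show ?thesis by blast
qed

lemma is_zero_extension_rho: "is_zero_extension u act rho"
  unfolding is_zero_extension_def left_module_def
proof (intro conjI allI ballI)
  show "ring Hy" by (rule ring_Hy)
  show "rho a (m + m') = rho a m + rho a m'" if a: "a \<in> carrier Hy" for a m m'
  proof -
    obtain x where "a = hc x" using Hy_cls[OF a] by blast
    then show ?thesis by (simp add: rho_def single_add additive.add[OF ev_additive] lookup_add)
  qed
  show "rho (a \<oplus>\<^bsub>Hy\<^esub> b) m = rho a m + rho b m" if a: "a \<in> carrier Hy" and b: "b \<in> carrier Hy" for a b m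
  proof -
    obtain x y where "a = hc x" "b = hc y" using Hy_cls[OF a] Hy_cls[OF b] by blast
    then show ?thesis by (simp add: rho_def Hy_ops H_alg_simps ev_add lookup_add)
  qed
  show "rho (a \<otimes>\<^bsub>Hy\<^esub> b) m = rho a (rho b m)" if a: "a \<in> carrier Hy" and b: "b \<in> carrier Hy" for a b m
  proof -
    obtain x where x: "a = hc x" using Hy_cls[OF a] by blast
    obtain y where y: "b = hc y" "ev y (Poly_Mapping.single 0 m) = Poly_Mapping.single 0 (rho b m)"
      using Hy_preserves_constants[OF b] by blast
    have "rho (a \<otimes>\<^bsub>Hy\<^esub> b) m = Poly_Mapping.lookup (ev x (ev y (Poly_Mapping.single 0 m))) 0"
      unfolding x y(1) by (simp add: rho_def Hy_ops H_alg_simps ev_mult)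
    also have "\<dots> = rho a (rho b m)" unfolding y(2) by (simp add: rho_def x)
    finally show ?thesis .
  qed
  show "rho \<one>\<^bsub>Hy\<^esub> m = m" for m
    by (simp add: rho_def Hy_ops H_alg_simps ev_one)
  show "rho (hc (const a)) m = act (cls K_rels (const a)) m" for a m
    by (simp add: rho_def ev_const) (simp add: scal0_def)
  show "rho (hc (gen (HC i))) m = act (cls K_rels (gen (KC i))) m" for i m
    by (simp add: rho_def ev_gen) (simp add: cl0_def)
  show "rho (hc (gen (HW w))) m = act (cls K_rels (gen (KW w))) m" for w m
    using G_inc[of w m] by (simp add: rho_def ev_gen) (simp add: wg0_def)
  show "rho (hc (gen (HY i))) m = 0" for i m
    using Y_inc[of i m] by (simp add: rho_def ev_gen)
qed

abbreviation ze :: "'n H_gen free_alg set \<Rightarrow> 'm \<Rightarrow> 'm" where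
  "ze \<equiv> zero_extension u act"

lemma is_zero_extension_ze: "is_zero_extension u act ze"
  unfolding zero_extension_def by (rule someI[of "is_zero_extension u act", OF is_zero_extension_rho])

lemma left_module_ze: "left_module Hy ze"
  using is_zero_extension_ze by (simp add: is_zero_extension_def)

text \<open>\<open>ze\<close> is an extension picked by choice, so its values are known only on
  generators; the agreement with the polynomial action is propagated from there through the
  generated ring.\<close>

lemma hact_single_0:
  assumes "h \<in> carrier Hy"
  shows "hact h (Poly_Mapping.single 0 m) = Poly_Mapping.single 0 (ze h m)"
proof -
  interpret Hy: ring Hy by (rule ring_Hy)
  have ze_add: "ze (a \<oplus>\<^bsub>H_alg u\<^esub> b) m = ze a m + ze b m"
    and ze_mult: "ze (a \<otimes>\<^bsub>H_alg u\<^esub> b) m = ze a (ze b m)"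
    if "a \<in> carrier Hy" "b \<in> carrier Hy" for a b m
    using that left_module_ze by (simp_all add: left_module_def Hy_ops)
  have ze_one: "ze \<one>\<^bsub>H_alg u\<^esub> m = m" for m
    using left_module_ze by (simp add: left_module_def Hy_ops)
  have ze_gens: "ze (hc (const a)) m = scal0 a m" "ze (hc (gen (HC i))) m = cl0 i m"
    "ze (hc (gen (HW w))) m = wg0 w m" "ze (hc (gen (HY i))) m = 0" for a i w m
    using is_zero_extension_ze by (simp_all add: is_zero_extension_def scal0_def cl0_def wg0_def)
  show ?thesis
    using assms unfolding carrier_Hy
  proof (induction arbitrary: m rule: generate_ring.induct)
    case one
    show ?case by (simp only: ze_one) (simp add: H_alg_simps ev_one)
  next
    case (incl h)
    then show ?case using G_inc Y_inc
      by (auto simp: Hy_gens_def ze_gens ev_const ev_gen)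
  next
    case (a_inv h)
    let ?h = "\<ominus>\<^bsub>H_alg u\<^esub> h"
    have h: "h \<in> carrier Hy" "?h \<in> carrier Hy"
      using a_inv(1) unfolding carrier_Hy by (auto intro: generate_ring.a_inv)
    obtain a where a: "h = hc a" using Hy_cls[OF h(1)] by blast
    \<comment> \<open>\<open>left_module\<close> states additivity alone, so that zero acts as 0,
      and hence that negatives act as negatives, is derived from it.\<close>
    have "ze (\<zero>\<^bsub>Hy\<^esub> \<oplus>\<^bsub>H_alg u\<^esub> \<zero>\<^bsub>Hy\<^esub>) m = ze \<zero>\<^bsub>Hy\<^esub> m + ze \<zero>\<^bsub>Hy\<^esub> m"
      by (rule ze_add) simp_all
    then have "ze \<zero>\<^bsub>H_alg u\<^esub> m = 0"
      using Hy.l_zero[OF Hy.zero_closed] by (simp add: Hy_ops)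
    moreover have "h \<oplus>\<^bsub>H_alg u\<^esub> ?h = \<zero>\<^bsub>H_alg u\<^esub>"
      using abelian_group.r_neg[OF ring.is_abelian_group[OF ring_H_alg]] h(1) carrier_Hy_subset
      by blast
    ultimately have "ze h m + ze ?h m = 0" using ze_add[OF h, of m] by simp
    then have "ze ?h m = - ze h m" by (simp add: eq_neg_iff_add_eq_0 add.commute)
    moreover have "hact ?h (Poly_Mapping.single 0 m) = - hact h (Poly_Mapping.single 0 m)"
      by (simp add: a H_alg_simps ev_minus)
    ultimately show ?case using a_inv(2) by (simp add: single_uminus)
  next
    case (eng_add h h')
    then have h: "h \<in> carrier Hy" "h' \<in> carrier Hy" by (simp_all add: carrier_Hy)
    then obtain a b where a: "h = hc a" "h' = hc b" using Hy_cls by blast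
    have "hact (h \<oplus>\<^bsub>H_alg u\<^esub> h') t = hact h t + hact h' t" for t
      by (simp add: a H_alg_simps ev_add)
    then show ?case using eng_add(3,4) by (simp add: ze_add[OF h] single_add)
  next
    case (eng_mult h h')
    then have h: "h \<in> carrier Hy" "h' \<in> carrier Hy" by (simp_all add: carrier_Hy)
    then obtain a b where a: "h = hc a" "h' = hc b" using Hy_cls by blast
    have "hact (h \<otimes>\<^bsub>H_alg u\<^esub> h') t = hact h (hact h' t)" for t
      by (simp add: a H_alg_simps ev_mult)
    then show ?case using eng_mult(3,4) by (simp add: ze_mult[OF h])
  qed
qed

sublocale tensor_product "H_alg u" "carrier Hy" ze
  by (rule tensor_product.intro[OF ring_H_alg carrier_Hy_subset])

end

section \<open>The identification with polynomials\<close>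

context K_module
begin

notation eqv (infix \<open>\<sim>\<^sub>J\<close> 50)

lemma hc_eq_rel: "a - b \<in> H_rels u \<Longrightarrow> hc a = hc b"
  by (rule cls_eq_rel)

lemma hc_mult_cong: "hc a = hc a' \<Longrightarrow> hc b = hc b' \<Longrightarrow> hc (a * b) = hc (a' * b')"
  by (simp flip: H_alg_simps(3))

lemma hc_in_carrier [simp]: "hc a \<in> carrier (H_alg u)"
  by (simp add: H_alg_simps)

lemma hc_x_commute: "hc (gen (HX i) * gen (HX j)) = hc (gen (HX j) * gen (HX i))"
  by (rule hc_eq_rel) (auto simp: H_rels_def Let_def)

lemma hc_x_power_commute: "hc (gen (HX i) * gen (HX j) ^ k) = hc (gen (HX j) ^ k * gen (HX i))"
proof (induction k)
  case (Suc k)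
  have "hc (gen (HX i) * gen (HX j) * gen (HX j) ^ k) = hc (gen (HX j) * gen (HX i) * gen (HX j) ^ k)"
    by (intro hc_mult_cong hc_x_commute refl)
  also have "\<dots> = hc (gen (HX j) * (gen (HX j) ^ k * gen (HX i)))"
    unfolding mult.assoc by (intro hc_mult_cong Suc refl)
  finally show ?case by (simp add: mult.assoc)
qed simp

text \<open>x_i commutes past the powers in front of its own and is absorbed there; distinctness
  ensures that no later factor has the index i.\<close>

lemma hc_x_mult_prod_list:
  assumes "distinct l" and "i \<in> set l"
  shows "hc (gen (HX i) * prod_list (map (\<lambda>j. gen (HX j) ^ Poly_Mapping.lookup \<alpha> j) l))
    = hc (prod_list (map (\<lambda>j. gen (HX j) ^
        Poly_Mapping.lookup (Poly_Mapping.single i 1 + \<alpha>) j) l))"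
  using assms
proof (induction l)
  case (Cons j l)
  show ?case
  proof (cases "j = i")
    case True
    then have "i \<notin> set l" using Cons by auto
    then have eq: "map (\<lambda>j. gen (HX j) ^ Poly_Mapping.lookup (Poly_Mapping.single i 1 + \<alpha>) j) l
        = map (\<lambda>j. gen (HX j) ^ Poly_Mapping.lookup \<alpha> j) l"
      by (auto simp: lookup_add lookup_single when_def)
    then show ?thesis using True
      by (simp only: list.map prod_list.Cons eq) (simp add: lookup_add mult.assoc)
  next
    case False
    let ?p = "\<lambda>\<alpha>. prod_list (map (\<lambda>j. gen (HX j) ^ Poly_Mapping.lookup \<alpha> j) l)"
    have "hc (gen (HX i) * gen (HX j) ^ Poly_Mapping.lookup \<alpha> j * ?p \<alpha>)
        = hc (gen (HX j) ^ Poly_Mapping.lookup \<alpha> j * gen (HX i) * ?p \<alpha>)"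
      by (intro hc_mult_cong hc_x_power_commute refl)
    also have "\<dots> = hc (gen (HX j) ^ Poly_Mapping.lookup \<alpha> j * ?p (Poly_Mapping.single i 1 + \<alpha>))"
      unfolding mult.assoc using Cons False by (intro hc_mult_cong Cons.IH refl) auto
    finally show ?thesis using False by (simp add: lookup_add lookup_single mult.assoc)
  qed
qed simp

lemma hc_x_mult_monomial:
  "hc (gen (HX i) * x_monomial \<alpha>) = hc (x_monomial (Poly_Mapping.single i 1 + \<alpha>))"
  unfolding x_monomial_def by (rule hc_x_mult_prod_list) simp_all

lemma x_monomial_0: "x_monomial (0 :: 'n \<Rightarrow>\<^sub>0 nat) = 1"
proof -
  have "prod_list (map (\<lambda>i. gen (HX i) ^ Poly_Mapping.lookup (0 :: 'n \<Rightarrow>\<^sub>0 nat) i) l) = 1" for l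
    by (induction l) simp_all
  then show ?thesis by (simp add: x_monomial_def)
qed

text \<open>Makes the action on constants a left inverse of the identification.\<close>

lemma ev_x_monomial: "ev (x_monomial \<alpha>) (Poly_Mapping.single 0 m) = Poly_Mapping.single \<alpha> m"
proof (induction \<alpha> rule: monomial_induct)
  case zero
  show ?case by (simp add: x_monomial_0 ev_one)
next
  case (step i \<alpha>)
  have "ev (x_monomial (Poly_Mapping.single i 1 + \<alpha>)) (Poly_Mapping.single 0 m)
      = ev (gen (HX i) * x_monomial \<alpha>) (Poly_Mapping.single 0 m)"
    using hc_x_mult_monomial hact_cls by metis
  then show ?case using step by (simp add: ev_mult ev_gen)
qed

text \<open>A representative in the free abelian group of the coset
  \<open>identification u act t\<close>; it is additive only up to congruence.\<close>

definition iota :: "('n, 'm) poly_tensor \<Rightarrow> ('n H_gen free_alg set \<times> 'm \<Rightarrow>\<^sub>0 int)" where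
  "iota t = (\<Sum>\<alpha>\<in>Poly_Mapping.keys t. frag_of (hc (x_monomial \<alpha>), Poly_Mapping.lookup t \<alpha>))"

lemma identification_eq: "identification u act t = tensor_coset (H_alg u) (carrier Hy) ze (iota t)"
  by (simp add: identification_def iota_def)

lemma iota_in_carrier: "iota t \<in> carrier F"
  unfolding iota_def by (rule sum_closed_free_Abelian_group) simp

text \<open>Letting a act on the constant m is balanced over H_y by \<open>hact_single_0\<close>, so
  it lifts to the tensor product, and the lift sends \<open>iota t\<close> back to t.\<close>

lemma identification_inj:
  assumes "identification u act t = identification u act t'"
  shows "t = t'"
proof -
  let ?\<phi> = "\<lambda>a m. hact a (Poly_Mapping.single 0 m)"
  have left: "?\<phi> (a \<oplus>\<^bsub>H_alg u\<^esub> b) m = ?\<phi> a m + ?\<phi> b m"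
    if "a \<in> carrier (H_alg u)" "b \<in> carrier (H_alg u)" for a b m
    using that by (auto simp: H_alg_simps ev_add)
  have right: "?\<phi> a (m + m') = ?\<phi> a m + ?\<phi> a m'" if "a \<in> carrier (H_alg u)" for a m m'
    using that by (auto simp: H_alg_simps single_add additive.add[OF ev_additive])
  have balanced: "?\<phi> (a \<otimes>\<^bsub>H_alg u\<^esub> s) m = ?\<phi> a (ze s m)"
    if a: "a \<in> carrier (H_alg u)" and s: "s \<in> carrier Hy" for a s m
  proof -
    obtain b c where "a = hc b" "s = hc c" using a Hy_cls[OF s] by (auto simp: H_alg_simps)
    then have "hact (a \<otimes>\<^bsub>H_alg u\<^esub> s) t = hact a (hact s t)" for t
      by (simp add: H_alg_simps ev_mult)
    then show ?thesis by (simp add: hact_single_0[OF s])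
  qed
  obtain \<Phi> where add: "\<And>z z'. z \<in> carrier F \<Longrightarrow> z' \<in> carrier F \<Longrightarrow> \<Phi> (z + z') = \<Phi> z + \<Phi> z'"
    and frag: "\<And>a m. a \<in> carrier (H_alg u) \<Longrightarrow> \<Phi> (frag_of (a, m)) = ?\<phi> a m"
    and eqv: "\<And>z z'. z \<in> carrier F \<Longrightarrow> z' \<in> carrier F \<Longrightarrow> z \<sim>\<^sub>J z' \<Longrightarrow> \<Phi> z = \<Phi> z'"
  proof -
    show thesis by (rule tensor_lift[of ?\<phi>]) (fact left right balanced that)+
  qed
  have zero: "\<Phi> 0 = 0" using add[of 0 0] by simp
  have sum: "\<Phi> (\<Sum>\<alpha>\<in>U. frag_of (hc (x_monomial \<alpha>), f \<alpha>)) = (\<Sum>\<alpha>\<in>U. Poly_Mapping.single \<alpha> (f \<alpha>))"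
    if "finite U" for U f
    using that
  proof (induction U rule: finite_induct)
    case (insert \<alpha> U)
    have "(\<Sum>\<alpha>\<in>U. frag_of (hc (x_monomial \<alpha>), f \<alpha>)) \<in> carrier F"
      by (rule sum_closed_free_Abelian_group) simp
    moreover have "frag_of (hc (x_monomial \<alpha>), f \<alpha>) \<in> carrier F" by simp
    ultimately show ?case using insert
      by (simp add: add frag ev_x_monomial del: carrier_free_Abelian_group_iff)
  qed (simp add: zero)
  have "\<Phi> (iota t) = t" for t
    unfolding iota_def by (simp add: sum poly_mapping_sum_single)
  moreover have "iota t \<sim>\<^sub>J iota t'"
    using assms by (simp add: identification_eq tensor_coset_eq_iff)
  ultimately show ?thesis using eqv[OF iota_in_carrier iota_in_carrier] by metis
qed

text \<open>\<open>iota\<close> sums over the support, which varies under addition. On a larger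
  index set the additional terms have zero right factor and lie in J, so two tensors can be compared
  over a common set.\<close>

lemma iota_superset:
  assumes "finite U" and "Poly_Mapping.keys t \<subseteq> U"
  shows "iota t \<sim>\<^sub>J (\<Sum>\<alpha>\<in>U. frag_of (hc (x_monomial \<alpha>), Poly_Mapping.lookup t \<alpha>))"
proof -
  let ?f = "\<lambda>\<alpha>. frag_of (hc (x_monomial \<alpha>), Poly_Mapping.lookup t \<alpha>)"
  have "sum ?f U = sum ?f (U - Poly_Mapping.keys t) + iota t"
    unfolding iota_def using assms by (simp add: sum.subset_diff)
  moreover have "sum ?f (U - Poly_Mapping.keys t) \<in> J"
    using frag_of_zero_right by (intro J_sum) (auto simp: eqv_def in_keys_iff)
  ultimately have "sum ?f U \<sim>\<^sub>J iota t" by (simp add: eqv_def)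
  then show ?thesis by (rule eqv_sym)
qed

lemma iota_add: "iota (s + t) \<sim>\<^sub>J iota s + iota t"
proof -
  let ?A = "Poly_Mapping.keys s \<union> Poly_Mapping.keys t"
  let ?f = "\<lambda>t. \<Sum>\<alpha>\<in>?A. frag_of (hc (x_monomial \<alpha>), Poly_Mapping.lookup t \<alpha>)"
  have "iota (s + t) \<sim>\<^sub>J ?f (s + t)"
    by (rule iota_superset) (simp_all add: keys_add)
  also have "?f (s + t) \<sim>\<^sub>J ?f s + ?f t"
    unfolding eqv_def sum.distrib[symmetric] sum_subtractf[symmetric]
    using frag_of_add_right by (intro J_sum) (auto simp: eqv_def lookup_add)
  also have "?f s + ?f t \<sim>\<^sub>J iota s + iota t"
    by (intro eqv_add eqv_sym[OF iota_superset]) auto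
  finally show ?thesis .
qed

lemma iota_single: "iota (Poly_Mapping.single \<alpha> m) \<sim>\<^sub>J frag_of (hc (x_monomial \<alpha>), m)"
  using iota_superset[of "{\<alpha>}" "Poly_Mapping.single \<alpha> m"] by simp

text \<open>A condition at a single \<open>t\<close>: for a fixed generator it spreads from the constants to all \<open>t\<close>
  because the generator can be commuted past the \<open>x\<^sub>i\<close>.\<close>

definition intertwines :: "'n H_gen free_alg \<Rightarrow> ('n, 'm) poly_tensor \<Rightarrow> bool" where
  "intertwines a t \<longleftrightarrow> L (hc a) (iota t) \<sim>\<^sub>J iota (ev a t)"

lemma intertwines_plus: "intertwines a s \<Longrightarrow> intertwines a t \<Longrightarrow> intertwines a (s + t)"
proof -
  assume a: "intertwines a s" "intertwines a t"
  have "L (hc a) (iota (s + t)) \<sim>\<^sub>J L (hc a) (iota s + iota t)"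
    by (intro L_eqv iota_add) simp
  also have "\<dots> = L (hc a) (iota s) + L (hc a) (iota t)" by (rule L_linear)
  also have "\<dots> \<sim>\<^sub>J iota (ev a s) + iota (ev a t)"
    using a unfolding intertwines_def by (rule eqv_add)
  also have "\<dots> \<sim>\<^sub>J iota (ev a (s + t))"
    unfolding additive.add[OF ev_additive] by (rule eqv_sym[OF iota_add])
  finally show ?thesis unfolding intertwines_def .
qed

lemma intertwines_add:
  assumes "intertwines a t" "intertwines b t"
  shows "intertwines (a + b) t"
proof -
  have "L (hc (a + b)) (iota t) \<sim>\<^sub>J L (hc a) (iota t) + L (hc b) (iota t)"
    using L_add[of "hc a" "hc b" "iota t"] iota_in_carrier[of t] by (simp only: H_alg_simps(2) hc_in_carrier)
  also have "\<dots> \<sim>\<^sub>J iota (ev a t) + iota (ev b t)"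
    using assms unfolding intertwines_def by (rule eqv_add)
  also have "\<dots> \<sim>\<^sub>J iota (ev (a + b) t)"
    unfolding ev_add by (rule eqv_sym[OF iota_add])
  finally show ?thesis unfolding intertwines_def .
qed

lemma intertwines_mult:
  assumes "intertwines a (ev b t)" "intertwines b t"
  shows "intertwines (a * b) t"
proof -
  have "L (hc (a * b)) (iota t) = L (hc a) (L (hc b) (iota t))"
    using L_mult[of "hc a" "hc b" "iota t"] iota_in_carrier[of t] by (simp only: H_alg_simps(3) hc_in_carrier)
  also have "\<dots> \<sim>\<^sub>J L (hc a) (iota (ev b t))"
    using assms(2) unfolding intertwines_def by (intro L_eqv) simp_all
  also have "\<dots> \<sim>\<^sub>J iota (ev (a * b) t)"
    using assms(1) unfolding intertwines_def ev_mult .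
  finally show ?thesis unfolding intertwines_def .
qed

lemma intertwines_cong: "hc a = hc b \<Longrightarrow> intertwines a t \<longleftrightarrow> intertwines b t"
  unfolding intertwines_def using hact_cls by metis

section \<open>The generators intertwine\<close>

lemma intertwines_x: "intertwines (gen (HX i)) t"
proof (induction t rule: poly_mapping_single_add_induct)
  case (single \<alpha> m)
  have "L (hc (gen (HX i))) (iota (Poly_Mapping.single \<alpha> m))
      \<sim>\<^sub>J L (hc (gen (HX i))) (frag_of (hc (x_monomial \<alpha>), m))"
    by (intro L_eqv iota_single) simp
  also have "\<dots> = frag_of (hc (x_monomial (Poly_Mapping.single i 1 + \<alpha>)), m)"
    by (simp add: H_alg_simps hc_x_mult_monomial)
  also have "\<dots> \<sim>\<^sub>J iota (ev (gen (HX i)) (Poly_Mapping.single \<alpha> m))"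
    by (simp add: ev_gen eqv_sym[OF iota_single])
  finally show ?case unfolding intertwines_def .
qed (rule intertwines_plus)

text \<open>On a constant the left factor is 1, so a can be regarded as multiplied from the right
  and moved across the tensor sign to act on m.\<close>

lemma intertwines_single_0:
  assumes "hc a \<in> carrier Hy"
  shows "intertwines a (Poly_Mapping.single 0 m)"
proof -
  have "L (hc a) (iota (Poly_Mapping.single 0 m)) \<sim>\<^sub>J L (hc a) (frag_of (hc 1, m))"
    using iota_single[of 0 m] by (intro L_eqv) (simp_all add: x_monomial_0)
  also have "\<dots> = frag_of (hc 1 \<otimes>\<^bsub>H_alg u\<^esub> hc a, m)" by (simp add: H_alg_simps)
  also have "\<dots> \<sim>\<^sub>J frag_of (hc 1, ze (hc a) m)"
    using assms by (intro frag_of_balanced) simp_all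
  also have "\<dots> \<sim>\<^sub>J iota (Poly_Mapping.single 0 (ze (hc a) m))"
    using eqv_sym[OF iota_single[of 0]] by (simp add: x_monomial_0)
  also have "\<dots> = iota (ev a (Poly_Mapping.single 0 m))"
    using hact_single_0[OF assms, of m] by simp
  finally show ?thesis unfolding intertwines_def .
qed

text \<open>The induction step common to the generators: rewriting a x_i inside the algebra trades a
  at x_i t for b at t. In the applications b is a product with a leading variable, up to sign and a
  term from K.\<close>

lemma intertwines_mul_x:
  assumes "hc (a * gen (HX i)) = hc b" and "intertwines b t"
  shows "intertwines a (mul_x i t)"
proof -
  have "L (hc a) (iota (mul_x i t)) \<sim>\<^sub>J L (hc a) (L (hc (gen (HX i))) (iota t))"
    using eqv_sym[OF intertwines_x[of i t, unfolded intertwines_def]]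
    by (intro L_eqv) (simp_all add: ev_gen)
  also have "\<dots> = L (hc (a * gen (HX i))) (iota t)"
    using L_mult[of "hc a" "hc (gen (HX i))" "iota t"] iota_in_carrier[of t]
    by (simp only: H_alg_simps(3) hc_in_carrier)
  also have "\<dots> \<sim>\<^sub>J iota (ev (a * gen (HX i)) t)"
    using assms intertwines_cong unfolding intertwines_def by blast
  finally show ?thesis unfolding intertwines_def by (simp add: ev_mult ev_gen)
qed

lemma intertwines_const: "intertwines (const z) t"
proof (induction t rule: X_rec)
  case (inc m)
  show ?case by (rule intertwines_single_0[OF Hy_gen_in(1)])
next
  case (Mx i t)
  have "const z * gen (HX i) = gen (HX i) * const z"
    by (simp add: const_def gen_def mult_single)
  then show ?case
    by (intro intertwines_mul_x[of _ _ "gen (HX i) * const z"] intertwines_mult intertwines_x Mx) simp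
qed (rule intertwines_plus)

lemma intertwines_minus: "intertwines a t \<Longrightarrow> intertwines (- a) t"
proof -
  assume a: "intertwines a t"
  \<comment> \<open>-1 is a scalar, so negation becomes a product with an element already known to
    intertwine.\<close>
  have "const (- 1) = (- 1 :: 'n H_gen free_alg)" by (simp add: const_def single_uminus)
  then have "intertwines (- 1) s" for s using intertwines_const[of "- 1" s] by simp
  from intertwines_mult[OF this a] show ?thesis by simp
qed

lemma intertwines_diff: "intertwines a t \<Longrightarrow> intertwines b t \<Longrightarrow> intertwines (a - b) t"
  using intertwines_add[of a t "- b"] intertwines_minus[of b t] by simp

lemma intertwines_one: "intertwines 1 t"
  using intertwines_const[of 1 t] by (simp add: const_def)

lemma intertwines_c: "intertwines (gen (HC j)) t"
proof (induction t rule: X_rec)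
  case (inc m)
  show ?case by (rule intertwines_single_0[OF Hy_gen_in(2)])
next
  case (Mx i t)
  show ?case
  proof (cases "i = j")
    case True
    have "hc (gen (HX i) * gen (HC i)) = hc (- (gen (HC i) * gen (HX i)))"
      by (rule hc_eq_rel) (auto simp: H_rels_def Let_def)
    then have "hc (gen (HC i) * gen (HX i)) = hc (- (gen (HX i) * gen (HC i)))"
      by (simp flip: H_alg_simps(5))
    then show ?thesis using True Mx
      by (intro intertwines_mul_x[of _ _ "- (gen (HX i) * gen (HC i))"] intertwines_mult
          intertwines_minus intertwines_x) simp_all
  next
    case False
    have "hc (gen (HC j) * gen (HX i)) = hc (gen (HX i) * gen (HC j))"
      by (rule sym, rule hc_eq_rel) (use False in \<open>auto simp: H_rels_def Let_def\<close>)
    then show ?thesis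
      by (intro intertwines_mul_x[of _ _ "gen (HX i) * gen (HC j)"] intertwines_mult
          intertwines_x Mx) simp
  qed
qed (rule intertwines_plus)

lemma intertwines_w: "intertwines (gen (HW w)) t"
proof (induction t rule: X_rec)
  case (inc m)
  show ?case by (rule intertwines_single_0[OF Hy_gen_in(3)])
next
  case (Mx i t)
  obtain v where v: "v * w = 1" "w * v = 1" using weyl_D_inverse by blast
  let ?x = "of_int (wsign w i) * gen (HX (wperm w i)) :: 'n H_gen free_alg"
  have "hc (gen (HW v) * gen (HW w)) = hc (gen (HW (v * w)))"
    by (rule hc_eq_rel) (auto simp: H_rels_def Let_def K_relations_def)
  also have "\<dots> = hc 1"
    unfolding v by (rule hc_eq_rel) (auto simp: H_rels_def Let_def K_relations_def)
  \<comment> \<open>The relation for w and x_i is a conjugation; multiplying it by w on the right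
    and cancelling v w leaves a commutation rule.\<close>
  finally have vw: "hc (gen (HW w) * gen (HX i) * (gen (HW v) * gen (HW w)))
      = hc (gen (HW w) * gen (HX i) * 1)"
    by (intro hc_mult_cong refl)
  have "hc (gen (HW w) * gen (HX i) * gen (HW v)) = hc ?x"
    by (rule hc_eq_rel) (use v in \<open>auto simp: H_rels_def Let_def\<close>)
  then have "hc (gen (HW w) * gen (HX i) * gen (HW v) * gen (HW w)) = hc (?x * gen (HW w))"
    by (rule hc_mult_cong[OF _ refl])
  with vw have "hc (gen (HW w) * gen (HX i)) = hc (?x * gen (HW w))"
    by (simp add: mult.assoc)
  moreover have "intertwines (of_int (wsign w i)) s" for s
    using wsign_cases[of w i] intertwines_one intertwines_minus by fastforce
  ultimately show ?case
    by (intro intertwines_mul_x[of _ _ "?x * gen (HW w)"] intertwines_mult intertwines_x Mx)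
qed (rule intertwines_plus)

lemma intertwines_0: "intertwines 0 t"
  using intertwines_diff[OF intertwines_one intertwines_one, of t] by simp

lemma intertwines_sum: "(\<And>k. k \<in> I \<Longrightarrow> intertwines (f k) t) \<Longrightarrow> intertwines (sum f I) t"
  by (induction I rule: infinite_finite_induct) (auto intro: intertwines_0 intertwines_add)

lemma intertwines_y: "intertwines (gen (HY j)) t"
proof (induction t rule: X_rec)
  case (inc m)
  show ?case by (rule intertwines_single_0[OF Hy_gen_in(4)])
next
  case (Mx i t)
  let ?c = "\<lambda>k. gen (HC k) :: 'n H_gen free_alg" and ?g = "\<lambda>w. gen (HW w) :: 'n H_gen free_alg"
  note K = intertwines_mult intertwines_add intertwines_diff intertwines_sum intertwines_minus
    intertwines_one intertwines_c intertwines_w intertwines_const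
  show ?case
  proof (cases "i = j")
    case False
    \<comment> \<open>This is the commutator [y_j, x_i]. It is built from K, whose generators
      intertwine at every tensor, and the remaining product x_i y_j is covered by the induction
      hypothesis.\<close>
    let ?k = "const u * ((1 + ?c j * ?c i) * ?g (s_refl i j) - (1 - ?c j * ?c i) * ?g (sbar_refl i j))"
    have "hc (gen (HY j) * gen (HX i)) = hc (gen (HX i) * gen (HY j) + ?k)"
      by (rule hc_eq_rel, unfold diff_diff_eq[symmetric])
        (use False in \<open>unfold H_rels_def Let_def, blast\<close>)
    moreover have "intertwines ?k t" by (intro K)
    ultimately show ?thesis
      by (intro intertwines_mul_x[of _ _ "gen (HX i) * gen (HY j) + ?k"] intertwines_add[of _ _ ?k]
          intertwines_mult[of "gen (HX i)"] intertwines_x Mx)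
  next
    case True
    let ?k = "const u * (\<Sum>k\<in>UNIV - {i}. (1 + ?c k * ?c i) * ?g (s_refl k i)
        + (1 - ?c k * ?c i) * ?g (sbar_refl k i))"
    \<comment> \<open>The diagonal relation adds \<open>?k\<close>, so here the commutator is its
      negative.\<close>
    have "gen (HY i) * gen (HX i) - gen (HX i) * gen (HY i) + ?k \<in> H_rels u"
      unfolding H_rels_def Let_def by blast
    then have "hc (gen (HY i) * gen (HX i)) = hc (gen (HX i) * gen (HY i) - ?k)"
      by (intro hc_eq_rel) (simp add: algebra_simps)
    moreover have "intertwines ?k t" by (intro K)
    ultimately show ?thesis using Mx True
      by (intro intertwines_mul_x[of _ _ "gen (HX i) * gen (HY i) - ?k"] intertwines_diff[of _ _ ?k]
          intertwines_mult[of "gen (HX i)"] intertwines_x) simp_all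
  qed
qed (rule intertwines_plus)

text \<open>\<open>intertwines_y\<close> exhibits the result in the induced module as the
  identification of \<open>dunkl_op i t\<close>, and \<open>inv_into\<close> undoes an injective map
  on its image.\<close>

lemma module_act_y: "module_act u act (hc (gen (HY i))) t = dunkl_op i t"
proof -
  have "induced_act (H_alg u) (carrier Hy) ze (hc (gen (HY i))) (identification u act t)
      = identification u act (dunkl_op i t)"
    unfolding identification_eq induced_act_coset[OF hc_in_carrier] tensor_coset_eq_iff
    using intertwines_y[of i t] by (simp add: intertwines_def ev_gen)
  moreover have "inj (identification u act)"
    by (rule injI) (rule identification_inj)
  ultimately show ?thesis unfolding module_act_def by simp
qed

end

theorem theorem4p16:
  fixes u :: complex
    and act :: "'n::{finite,linorder} K_gen free_alg set \<Rightarrow> 'm::ab_group_add \<Rightarrow> 'm"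
    and f :: "'n poly_ring" and m :: 'm and i :: 'n
  assumes "CARD('n) \<ge> 4"
    and "left_module (K_alg :: 'n K_gen free_alg set ring) act"
  defines "s \<equiv> \<lambda>k i. cls K_rels (gen (KW (s_refl k i)))"
    and "sbar \<equiv> \<lambda>k i. cls K_rels (gen (KW (sbar_refl k i)))"
    and "cc \<equiv> \<lambda>k i. cls K_rels (gen (KC k) * gen (KC i))"
  shows "module_act u act (cls (H_rels u) (gen (HY i))) (pure_tensor act f m) =
    tensor_scale act (- u) (\<Sum>k\<in>UNIV - {i}.
        pure_tensor act (ddiff i k f) (act (s k i) m)
      + pure_tensor act (ddiff_bar i k f) (act (cc k i) (act (s k i) m)))
  + tensor_scale act (- u) (\<Sum>k\<in>UNIV - {i}.
        pure_tensor act (ddiff_bar i k f) (act (sbar k i) m)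
      - pure_tensor act (ddiff i k f) (act (cc k i) (act (sbar k i) m)))"
proof -
  interpret K_module u act by unfold_locales (rule assms(2))
  show ?thesis
    \<comment> \<open>\<open>act_mult\<close> splits the action of c_k c_i into two successive
      operators, the form used in \<open>dunkl\<close>.\<close>
    unfolding module_act_y dunkl_op_pt dunkl_def s_def sbar_def cc_def act_mult
    by (simp add: cl0_def wg0_def)
qed

end
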